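(* Let $R$ be a nonvoid relation on $X\times Y$ and let $(\sigma,\gamma)\in P_R$. Let $Q=Q(\sigma,\gamma)$ be the relation modeling the link of $\sigma$ restricted to $\gamma$. Suppose $P_Q$ is well-defined and has reduced integral homology in dimension $k\geq 0$, that is, $\widetilde H_k(\Delta(P_Q);\mathbb{Z})\neq0$. Then there are at least $(k+2)!$ distinct informative attribute release sequences $y_1,\dots,y_\ell$ for $R$, each with $\ell\geq k+2$, such that $\psi_R(\{y_1,\dots,y_\ell\})=\sigma$. Consequently, $r_{\mathrm{slow}}(\sigma)\geq k+2$.
   Context: Everything is finite. A relation $R$ on $X\times Y$ is a subset of $X\times Y$; it is nonvoid if $X\neq\emptyset$ and $Y\ne\emptyset$. $Y_x=\{y\in Y:(x,y)\in R\}$ and $X_y=\{x\in X:(x,y)\in R\}$. For $\sigma\subseteq X$, $\phi_R(\sigma)=\bigcap_{x\in\sigma}Y_x$ with $\phi_R(\emptyset)=Y$; for $\gamma\subseteq Y$, $\psi_R(\gamma)=\bigcap_{y\in\gamma}X_y$ with $\psi_R(\emptyset)=X$. For nonvoid $R$, the Dowker complexes are $\Phi_R=\{\gamma\subseteq Y:\exists x\in X\ \forall y\in\gamma\ (x,y)\in R\}$ and $\Psi_R=\{\sigma\subseteq X:\exists y\in Y\ \forall x\in\sigma\ (x,y)\in R\}$. The doubly-labeled poset $P_R$ consists of all pairs $(\sigma,\gamma)$ with $\emptyset\neq\sigma\in\Psi_R$, $\emptyset\ne\gamma\in\Phi_R$, $\sigma=\psi_R(\gamma)$ and $\gamma=\phi_R(\sigma)$,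 ordered by $(\sigma_1,\gamma_1)\le(\sigma_2,\gamma_2)$ iff $\sigma_1\subseteq\sigma_2$. If a relation's Dowker complexes are both the empty complex $\{\emptyset\}$, its doubly-labeled poset is $\emptyset$; if they are void (no simplices), its doubly-labeled poset is undefined. For $\sigma\in\Psi_R$ and $\gamma\subseteq\phi_R(\sigma)$, the relation $Q(\sigma,\gamma)$ modeling the link of $\sigma$ restricted to $\gamma$ is the restriction of $R$ to $\overline X\times\gamma$ with $\overline X=\bigcup_{y\in\gamma}(X_y\setminus\sigma)$. Its Dowker complexes are defined in the standard way, except: if $\sigma=X$ they are void; if $\sigma\ne X$ but $\overline X=\emptyset$ they are $\{\emptyset\}$. An attribute release sequence for $R$ is a nonempty set of attributes of $Y$ released in a particular sequential order $y_1,\dots,y_m$ ($m\ge1$); it is informative if $y_i\notin(\phi_R\circ\psi_R)(\{y_1,\dots,y_{i-1}\})$ for all $1\le i\le m$. For $(\sigma,\gamma)\in P_R$, $r_{\mathrm{slow}}(\sigma)$ is the maximum $m$ for which there is an informative attribute release sequence $y_1,\dots,y_m$ for $R$ with $\psi_R(\{y_1,\dots,y_m\})=\sigma$. $\Delta(P)$ is the order complex of a poset $P$ (simplices are the chains of $P$); $\widetilde H_k$ is reduced simplicial homology. *)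

theory Defs
  imports "HOL-Algebra.Elementary_Groups"
begin

section \<open>Relations and their Dowker complexes\<close>

definition nonvoid_relation :: "'a set \<Rightarrow> 'b set \<Rightarrow> ('a \<times> 'b) set \<Rightarrow> bool" where
  "nonvoid_relation X Y R \<longleftrightarrow> R \<subseteq> X \<times> Y \<and> X \<noteq> {} \<and> Y \<noteq> {}"

definition attributes_of :: "'b set \<Rightarrow> ('a \<times> 'b) set \<Rightarrow> 'a \<Rightarrow> 'b set" where
  "attributes_of Y R x = {y \<in> Y. (x, y) \<in> R}"

definition individuals_with :: "'a set \<Rightarrow> ('a \<times> 'b) set \<Rightarrow> 'b \<Rightarrow> 'a set" where
  "individuals_with X R y = {x \<in> X. (x, y) \<in> R}"

text \<open>Intersecting with the ambient set yields the conventions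
  \<open>phi Y R {} = Y\<close> and \<open>psi X R {} = X\<close>.\<close>

definition phi :: "'b set \<Rightarrow> ('a \<times> 'b) set \<Rightarrow> 'a set \<Rightarrow> 'b set" where
  "phi Y R \<sigma> = Y \<inter> (\<Inter>x\<in>\<sigma>. attributes_of Y R x)"

definition psi :: "'a set \<Rightarrow> ('a \<times> 'b) set \<Rightarrow> 'b set \<Rightarrow> 'a set" where
  "psi X R \<gamma> = X \<inter> (\<Inter>y\<in>\<gamma>. individuals_with X R y)"

definition Phi :: "'a set \<Rightarrow> 'b set \<Rightarrow> ('a \<times> 'b) set \<Rightarrow> 'b set set" where
  "Phi X Y R = {\<gamma>. \<gamma> \<subseteq> Y \<and> (\<exists>x\<in>X. \<forall>y\<in>\<gamma>. (x, y) \<in> R)}"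

definition Psi :: "'a set \<Rightarrow> 'b set \<Rightarrow> ('a \<times> 'b) set \<Rightarrow> 'a set set" where
  "Psi X Y R = {\<sigma>. \<sigma> \<subseteq> X \<and> (\<exists>y\<in>Y. \<forall>x\<in>\<sigma>. (x, y) \<in> R)}"

section \<open>Doubly-labeled posets\<close>

text \<open>The Dowker complexes are separate arguments because those of a link relation are
  subject to conventions of their own in the degenerate cases. If they are both
  \<open>{{}}\<close>, the poset is empty.\<close>

definition labeled_pairs ::
    "'a set \<Rightarrow> 'b set \<Rightarrow> ('a \<times> 'b) set \<Rightarrow> 'b set set \<Rightarrow> 'a set set \<Rightarrow> ('a set \<times> 'b set) set" where
  "labeled_pairs X Y R \<Phi> \<Psi> =
     {(\<sigma>, \<gamma>). \<sigma> \<noteq> {} \<and> \<sigma> \<in> \<Psi> \<and> \<gamma> \<noteq> {} \<and> \<gamma> \<in> \<Phi> \<and> \<sigma> = psi X R \<gamma> \<and> \<gamma> = phi Y R \<sigma>}"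

definition doubly_labeled_poset ::
    "'a set \<Rightarrow> 'b set \<Rightarrow> ('a \<times> 'b) set \<Rightarrow> ('a set \<times> 'b set) set" where
  "doubly_labeled_poset X Y R = labeled_pairs X Y R (Phi X Y R) (Psi X Y R)"

definition dl_le :: "'a set \<times> 'b set \<Rightarrow> 'a set \<times> 'b set \<Rightarrow> bool" where
  "dl_le p q \<longleftrightarrow> fst p \<subseteq> fst q"

section \<open>The relation modeling a restricted link\<close>

definition link_individuals :: "'a set \<Rightarrow> ('a \<times> 'b) set \<Rightarrow> 'a set \<Rightarrow> 'b set \<Rightarrow> 'a set" where
  "link_individuals X R \<sigma> \<gamma> = (\<Union>y\<in>\<gamma>. individuals_with X R y - \<sigma>)"

definition link_relation ::
    "'a set \<Rightarrow> ('a \<times> 'b) set \<Rightarrow> 'a set \<Rightarrow> 'b set \<Rightarrow> ('a \<times> 'b) set" where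
  "link_relation X R \<sigma> \<gamma> = R \<inter> (link_individuals X R \<sigma> \<gamma> \<times> \<gamma>)"

definition link_Phi :: "'a set \<Rightarrow> ('a \<times> 'b) set \<Rightarrow> 'a set \<Rightarrow> 'b set \<Rightarrow> 'b set set" where
  "link_Phi X R \<sigma> \<gamma> =
     (if \<sigma> = X then {}
      else if link_individuals X R \<sigma> \<gamma> = {} then {{}}
      else Phi (link_individuals X R \<sigma> \<gamma>) \<gamma> (link_relation X R \<sigma> \<gamma>))"

definition link_Psi :: "'a set \<Rightarrow> ('a \<times> 'b) set \<Rightarrow> 'a set \<Rightarrow> 'b set \<Rightarrow> 'a set set" where
  "link_Psi X R \<sigma> \<gamma> =
     (if \<sigma> = X then {}
      else if link_individuals X R \<sigma> \<gamma> = {} then {{}}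
      else Psi (link_individuals X R \<sigma> \<gamma>) \<gamma> (link_relation X R \<sigma> \<gamma>))"

text \<open>The doubly-labeled poset is undefined exactly when the Dowker complexes are void.\<close>

definition link_poset_defined :: "'a set \<Rightarrow> ('a \<times> 'b) set \<Rightarrow> 'a set \<Rightarrow> 'b set \<Rightarrow> bool" where
  "link_poset_defined X R \<sigma> \<gamma> \<longleftrightarrow> link_Phi X R \<sigma> \<gamma> \<noteq> {} \<and> link_Psi X R \<sigma> \<gamma> \<noteq> {}"

definition link_poset ::
    "'a set \<Rightarrow> ('a \<times> 'b) set \<Rightarrow> 'a set \<Rightarrow> 'b set \<Rightarrow> ('a set \<times> 'b set) set" where
  "link_poset X R \<sigma> \<gamma> =
     labeled_pairs (link_individuals X R \<sigma> \<gamma>) \<gamma> (link_relation X R \<sigma> \<gamma>)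
       (link_Phi X R \<sigma> \<gamma>) (link_Psi X R \<sigma> \<gamma>)"

section \<open>Attribute release sequences\<close>

text \<open>A sequence releases a set of attributes in some order, hence has no repetitions.\<close>

definition attribute_release_sequence :: "'b set \<Rightarrow> 'b list \<Rightarrow> bool" where
  "attribute_release_sequence Y ys \<longleftrightarrow> ys \<noteq> [] \<and> distinct ys \<and> set ys \<subseteq> Y"

definition informative_release_sequence ::
    "'a set \<Rightarrow> 'b set \<Rightarrow> ('a \<times> 'b) set \<Rightarrow> 'b list \<Rightarrow> bool" where
  "informative_release_sequence X Y R ys \<longleftrightarrow>
     attribute_release_sequence Y ys \<and>
     (\<forall>i < length ys. ys ! i \<notin> (phi Y R \<circ> psi X R) (set (take i ys)))"

definition r_slow :: "'a set \<Rightarrow> 'b set \<Rightarrow> ('a \<times> 'b) set \<Rightarrow> 'a set \<Rightarrow> nat" where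
  "r_slow X Y R \<sigma> =
     Max {length ys |ys. informative_release_sequence X Y R ys \<and> psi X R (set ys) = \<sigma>}"

section \<open>Order complexes and reduced simplicial homology\<close>

definition order_complex :: "('v \<Rightarrow> 'v \<Rightarrow> bool) \<Rightarrow> 'v set \<Rightarrow> 'v set set" where
  "order_complex ord P = {C. C \<subseteq> P \<and> finite C \<and> Complete_Partial_Order.chain ord C}"

text \<open>Integral oriented chains of a simplicial complex \<open>K\<close> on simplices with \<open>n\<close> vertices
  (that is, of dimension \<open>n - 1\<close>; \<open>n = 0\<close> is the augmentation degree, whose only simplex
  is the empty one). A chain is a finitely supported function on ordered simplices that
  changes sign under transpositions of vertices: the value at \<open>[v\<^sub>0, \<dots>, v\<^sub>p]\<close> is the
  coefficient of the simplex with that orientation.\<close>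

definition oriented_chains :: "'v set set \<Rightarrow> nat \<Rightarrow> ('v list \<Rightarrow> int) set" where
  "oriented_chains K n =
     {c. finite {vs. c vs \<noteq> 0} \<and>
         (\<forall>vs. c vs \<noteq> 0 \<longrightarrow> length vs = n \<and> distinct vs \<and> set vs \<in> K) \<and>
         (\<forall>us v w ws. c (us @ v # w # ws) = - c (us @ w # v # ws))}"

definition chain_group :: "'v set set \<Rightarrow> nat \<Rightarrow> ('v list \<Rightarrow> int) monoid" where
  "chain_group K n =
     \<lparr>carrier = oriented_chains K n, mult = (\<lambda>c d vs. c vs + d vs), one = (\<lambda>vs. 0)\<rparr>"

text \<open>The usual boundary, sending \<open>[v\<^sub>0, \<dots>, v\<^sub>p]\<close> to the sum over \<open>i\<close> of
  \<open>(-1)\<^sup>i [v\<^sub>0, \<dots>, v\<^sub>i\<^sub>-\<^sub>1, v\<^sub>i\<^sub>+\<^sub>1, \<dots>, v\<^sub>p]\<close>: moving \<open>v\<^sub>i\<close> to the front costs the sign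
  \<open>(-1)\<^sup>i\<close>, so the coefficient of the boundary of \<open>c\<close> at \<open>vs\<close> collects the values of \<open>c\<close>
  at all \<open>v # vs\<close>. On vertices (\<open>n = 1\<close>) it is the augmentation.\<close>

definition simplicial_boundary :: "('v list \<Rightarrow> int) \<Rightarrow> ('v list \<Rightarrow> int)" where
  "simplicial_boundary c vs = (\<Sum>v | c (v # vs) \<noteq> 0. c (v # vs))"

definition cycle_group :: "'v set set \<Rightarrow> nat \<Rightarrow> ('v list \<Rightarrow> int) monoid" where
  "cycle_group K n = (chain_group K n)
     \<lparr>carrier := kernel (chain_group K n) (chain_group K (n - 1)) simplicial_boundary\<rparr>"

text \<open>A simplex of dimension \<open>k\<close> has \<open>k + 1\<close> vertices.\<close>

definition reduced_homology_group ::
    "nat \<Rightarrow> 'v set set \<Rightarrow> (('v list \<Rightarrow> int) set) monoid" where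
  "reduced_homology_group k K =
     cycle_group K (k + 1) Mod (simplicial_boundary ` carrier (chain_group K (k + 2)))"

subsection \<open>The homology of a simplicial complex is a group\<close>

lemma oriented_chainsI:
  assumes "finite {vs. c vs \<noteq> 0}"
    and "\<And>vs. c vs \<noteq> 0 \<Longrightarrow> length vs = n \<and> distinct vs \<and> set vs \<in> K"
    and "\<And>us v w ws. c (us @ v # w # ws) = - c (us @ w # v # ws)"
  shows "c \<in> oriented_chains K n"
  using assms unfolding oriented_chains_def by blast

lemma oriented_chainsD:
  assumes "c \<in> oriented_chains K n"
  shows "finite {vs. c vs \<noteq> 0}"
    and "c vs \<noteq> 0 \<Longrightarrow> length vs = n \<and> distinct vs \<and> set vs \<in> K"
    and "c (us @ v # w # ws) = - c (us @ w # v # ws)"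
  using assms unfolding oriented_chains_def by blast+

lemma oriented_chains_add:
  assumes "c \<in> oriented_chains K n" "d \<in> oriented_chains K n"
  shows "(\<lambda>vs. c vs + d vs) \<in> oriented_chains K n"
proof (rule oriented_chainsI)
  have "{vs. c vs + d vs \<noteq> 0} \<subseteq> {vs. c vs \<noteq> 0} \<union> {vs. d vs \<noteq> 0}" by auto
  then show "finite {vs. c vs + d vs \<noteq> 0}"
    using oriented_chainsD(1)[OF assms(1)] oriented_chainsD(1)[OF assms(2)]
    by (meson finite_UnI finite_subset)
next
  fix vs assume "c vs + d vs \<noteq> 0"
  then have "c vs \<noteq> 0 \<or> d vs \<noteq> 0" by auto
  then show "length vs = n \<and> distinct vs \<and> set vs \<in> K"
    using oriented_chainsD(2)[OF assms(1)] oriented_chainsD(2)[OF assms(2)] by blast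
next
  fix us v w ws
  show "c (us @ v # w # ws) + d (us @ v # w # ws) = - (c (us @ w # v # ws) + d (us @ w # v # ws))"
    using oriented_chainsD(3)[OF assms(1), of us v w ws]
      oriented_chainsD(3)[OF assms(2), of us v w ws] by simp
qed

lemma oriented_chains_uminus:
  assumes "c \<in> oriented_chains K n"
  shows "(\<lambda>vs. - c vs) \<in> oriented_chains K n"
proof (rule oriented_chainsI)
  show "- c (us @ v # w # ws) = - (- c (us @ w # v # ws))" for us v w ws
    using oriented_chainsD(3)[OF assms, of us v w ws] by linarith
qed (use oriented_chainsD(1,2)[OF assms] in auto)

lemma oriented_chains_zero: "(\<lambda>vs. 0) \<in> oriented_chains K n"
  unfolding oriented_chains_def by simp

lemma comm_group_chain_group: "comm_group (chain_group K n)"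
proof (rule comm_groupI)
  fix c assume "c \<in> carrier (chain_group K n)"
  then show "\<exists>d\<in>carrier (chain_group K n). d \<otimes>\<^bsub>chain_group K n\<^esub> c = \<one>\<^bsub>chain_group K n\<^esub>"
    by (intro bexI[of _ "\<lambda>vs. - c vs"]) (auto simp: chain_group_def oriented_chains_uminus)
qed (auto simp: chain_group_def oriented_chains_add oriented_chains_zero algebra_simps)

lemma simplicial_boundary_eq:
  assumes "c \<in> oriented_chains K n"
  shows "simplicial_boundary c vs = (\<Sum>v\<in>\<Union>(set ` {vs. c vs \<noteq> 0}). c (v # vs))"
  unfolding simplicial_boundary_def
proof (rule sum.mono_neutral_left)
  show "finite (\<Union>(set ` {vs. c vs \<noteq> 0}))"
    using oriented_chainsD(1)[OF assms] by auto
  show "{v. c (v # vs) \<noteq> 0} \<subseteq> \<Union>(set ` {vs. c vs \<noteq> 0})"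
    by force
qed auto

lemma simplicial_boundary_eq':
  assumes "c \<in> oriented_chains K n" "finite V" "\<Union>(set ` {vs. c vs \<noteq> 0}) \<subseteq> V"
  shows "simplicial_boundary c vs = (\<Sum>v\<in>V. c (v # vs))"
  unfolding simplicial_boundary_eq[OF assms(1)]
  using assms(2,3) by (intro sum.mono_neutral_left) force+

lemma simplicial_boundary_nonzero:
  "simplicial_boundary c vs \<noteq> 0 \<Longrightarrow> \<exists>v. c (v # vs) \<noteq> 0"
  unfolding simplicial_boundary_def by (metis (mono_tags, lifting) mem_Collect_eq sum.neutral)

lemma simplicial_boundary_closed:
  assumes K: "\<forall>S\<in>K. \<forall>T\<subseteq>S. T \<in> K"
    and c: "c \<in> oriented_chains K (Suc n)"
  shows "simplicial_boundary c \<in> oriented_chains K n"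
proof (rule oriented_chainsI)
  have "{vs. simplicial_boundary c vs \<noteq> 0} \<subseteq> tl ` {vs. c vs \<noteq> 0}"
    by (force dest: simplicial_boundary_nonzero)
  then show "finite {vs. simplicial_boundary c vs \<noteq> 0}"
    using oriented_chainsD(1)[OF c] by (meson finite_imageI finite_subset)
next
  fix vs assume "simplicial_boundary c vs \<noteq> 0"
  then obtain v where "c (v # vs) \<noteq> 0" by (blast dest: simplicial_boundary_nonzero)
  from oriented_chainsD(2)[OF c this] show "length vs = n \<and> distinct vs \<and> set vs \<in> K"
    using K by (metis distinct.simps(2) length_Cons old.nat.inject set_subset_Cons)
next
  fix us v w ws
  have "c (u # us @ v # w # ws) = - c (u # us @ w # v # ws)" for u
    by (rule oriented_chainsD(3)[OF c, of "u # us", unfolded append_Cons])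
  then show "simplicial_boundary c (us @ v # w # ws) = - simplicial_boundary c (us @ w # v # ws)"
    unfolding simplicial_boundary_eq[OF c] sum_negf[symmetric] by (intro sum.cong refl) auto
qed

lemma simplicial_boundary_add:
  assumes "c \<in> oriented_chains K n" "d \<in> oriented_chains K n"
  shows "simplicial_boundary (\<lambda>vs. c vs + d vs) vs
       = simplicial_boundary c vs + simplicial_boundary d vs"
proof -
  let ?S = "\<lambda>c. \<Union>(set ` {vs. (c :: 'a list \<Rightarrow> int) vs \<noteq> 0})"
  let ?V = "?S c \<union> ?S d"
  have V: "finite ?V"
    using oriented_chainsD(1)[OF assms(1)] oriented_chainsD(1)[OF assms(2)] by auto
  have "?S (\<lambda>vs. c vs + d vs) \<subseteq> ?V" by force
  then show ?thesis
    using simplicial_boundary_eq'[OF oriented_chains_add[OF assms] V]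
      simplicial_boundary_eq'[OF assms(1) V] simplicial_boundary_eq'[OF assms(2) V]
    by (simp add: sum.distrib)
qed

lemma simplicial_boundary_boundary:
  assumes K: "\<forall>S\<in>K. \<forall>T\<subseteq>S. T \<in> K"
    and c: "c \<in> oriented_chains K (Suc n)"
  shows "simplicial_boundary (simplicial_boundary c) vs = 0"
proof (cases n)
  case 0
  have "\<not> c (u # v # vs) \<noteq> 0" for u v
    using oriented_chainsD(2)[OF c, of "u # v # vs"] 0 by auto
  then show ?thesis by (simp add: simplicial_boundary_def)
next
  case (Suc m)
  let ?V = "\<Union>(set ` {vs. c vs \<noteq> 0})"
  have V: "finite ?V" using oriented_chainsD(1)[OF c] by auto
  have "\<Union>(set ` {vs. simplicial_boundary c vs \<noteq> 0}) \<subseteq> ?V"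
    by (force dest: simplicial_boundary_nonzero)
  then have eq: "simplicial_boundary (simplicial_boundary c) vs
      = (\<Sum>v\<in>?V. \<Sum>u\<in>?V. c (u # v # vs))"
    using simplicial_boundary_eq'[OF simplicial_boundary_closed[OF K c] V]
    by (simp add: simplicial_boundary_eq[OF c])
  also have "\<dots> = (\<Sum>v\<in>?V. \<Sum>u\<in>?V. c (v # u # vs))"
    by (rule sum.swap)
  also have "\<dots> = - (\<Sum>v\<in>?V. \<Sum>u\<in>?V. c (u # v # vs))"
    unfolding sum_negf[symmetric]
    by (intro sum.cong refl oriented_chainsD(3)[OF c, of "[]", simplified])
  finally show ?thesis using eq by simp
qed

lemma comm_group_reduced_homology_group:
  assumes K: "\<forall>S\<in>K. \<forall>T\<subseteq>S. T \<in> K"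
  shows "comm_group (reduced_homology_group k K)"
proof -
  have hom: "group_hom (chain_group K (Suc n)) (chain_group K n) simplicial_boundary" for n
  proof (intro group_hom.intro group_hom_axioms.intro)
    show "simplicial_boundary \<in> hom (chain_group K (Suc n)) (chain_group K n)"
      using simplicial_boundary_closed[OF K, where n = n] simplicial_boundary_add
      by (fastforce simp: hom_def chain_group_def)
  qed (use comm_group_chain_group comm_group_def in blast)+
  interpret c: comm_group "chain_group K (Suc k)" by (rule comm_group_chain_group)
  interpret g: group_hom "chain_group K (Suc k)" "chain_group K k" simplicial_boundary
    by (rule hom)
  interpret h: group_hom "chain_group K (Suc (Suc k))" "chain_group K (Suc k)" simplicial_boundary
    by (rule hom)
  let ?B = "simplicial_boundary ` carrier (chain_group K (Suc (Suc k)))"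
  have Z: "subgroup (kernel (chain_group K (Suc k)) (chain_group K k) simplicial_boundary)
      (chain_group K (Suc k))"
    by (rule g.subgroup_kernel)
  have "comm_group (cycle_group K (Suc k))"
    unfolding cycle_group_def diff_Suc_1
    using c.subgroup_imp_group[OF Z] c.m_comm subgroup.mem_carrier[OF Z]
    by (intro group.group_comm_groupI) auto
  moreover have "?B \<subseteq> kernel (chain_group K (Suc k)) (chain_group K k) simplicial_boundary"
    using simplicial_boundary_boundary[OF K] simplicial_boundary_closed[OF K]
    by (auto simp: kernel_def chain_group_def)
  then have "subgroup ?B (cycle_group K (Suc k))"
    unfolding cycle_group_def diff_Suc_1
    using h.img_is_subgroup Z c.subgroup_incl[of ?B] by blast
  ultimately show ?thesis
    unfolding reduced_homology_group_def
    using comm_group.abelian_FactGroup by auto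
qed

lemma comm_group_reduced_homology_order_complex:
  "comm_group (reduced_homology_group k (order_complex ord P))"
  by (rule comm_group_reduced_homology_group)
    (auto simp: order_complex_def Complete_Partial_Order.chain_def intro: finite_subset)

end

theory Submission
  imports Defs
begin

text \<open>Call a set \<open>A \<subseteq> \<gamma>\<close> a face if \<open>psi A \<noteq> \<sigma>\<close>. Sending a face to its closed pair makes the
  order complex of the link poset a retract of the order complex of the poset of nonempty
  faces, so the latter has homology in degree \<open>k\<close> as well.

  More generally, consider the faces \<open>A\<close> with \<open>B \<subset> A \<subseteq> B \<union> \<Gamma>\<close> and induct on \<open>\<Gamma>\<close>. For
  \<open>y \<in> \<Gamma>\<close> the link of the face \<open>B \<union> {y}\<close> is the same kind of poset for
  \<open>B \<union> {y}\<close> and \<open>\<Gamma> - {y}\<close>; once \<open>B \<union> {y}\<close> is deleted, what remains is equivalent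
  to the poset for \<open>B\<close> and \<open>\<Gamma> - {y}\<close>. If some such link has no homology in degree
  \<open>k - 1\<close>, then \<open>y\<close> can be discarded. Otherwise every \<open>y \<in> \<Gamma>\<close> extends to at least
  \<open>(k + 1)!\<close> sequences starting with \<open>y\<close> (no \<open>y\<close> is uninformative, as
  \<open>psi (B \<union> {y}) = psi B\<close> makes the poset contractible via \<open>A \<mapsto> A \<union> {y}\<close>), and \<open>\<Gamma>\<close> has at least \<open>k + 2\<close> elements, as
  otherwise the poset has no chain of \<open>k + 1\<close> elements or it has a greatest element.\<close>

section \<open>Alternating chains\<close>

text \<open>As in \<open>oriented_chains\<close>, the degree \<open>n\<close> is the number of vertices, one more than
  the dimension.\<close>

definition acyclic_at :: "nat \<Rightarrow> 'v set set \<Rightarrow> bool" where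
  "acyclic_at n K \<longleftrightarrow> (\<forall>c\<in>oriented_chains K n. (\<forall>vs. simplicial_boundary c vs = 0) \<longrightarrow>
     (\<exists>d\<in>oriented_chains K (Suc n). simplicial_boundary d = c))"

text \<open>Keeps only the sign rule of \<open>oriented_chains\<close>, so that inductions on vertex
  lists can fix a first vertex without tracking degree and support.\<close>

definition alternating :: "('v list \<Rightarrow> int) \<Rightarrow> bool" where
  "alternating c \<longleftrightarrow> (\<forall>us v w ws. c (us @ v # w # ws) = - c (us @ w # v # ws))"

lemma alternatingD:
  assumes "alternating c"
  shows "c (us @ v # w # ws) = - c (us @ w # v # ws)"
  using assms[unfolded alternating_def, rule_format, of us v w ws] .

lemma alternating_swap: "alternating c \<Longrightarrow> c (v # w # ws) = - c (w # v # ws)"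
  using alternatingD[of c "[]" v w ws] by simp

lemma alternating_Cons:
  assumes "alternating c"
  shows "alternating (\<lambda>vs. c (v # vs))"
  unfolding alternating_def
proof (intro allI)
  fix us a b ws
  show "c (v # us @ a # b # ws) = - c (v # us @ b # a # ws)"
    using alternatingD[OF assms, of "v # us" a b ws] by simp
qed

lemma alternating_sum:
  assumes "\<And>x. x \<in> A \<Longrightarrow> alternating (g x)"
  shows "alternating (\<lambda>vs. \<Sum>x\<in>A. g x vs)"
  unfolding alternating_def sum_negf[symmetric]
  by (intro allI sum.cong refl alternatingD[OF assms])

lemma oriented_chains_alternating:
  assumes "c \<in> oriented_chains K n"
  shows "alternating c"
  unfolding alternating_def by (intro allI oriented_chainsD(3)[OF assms])

text \<open>Swap the first \<open>v\<close> with its neighbour and continue in the slice at that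
  neighbour. Once the two copies are adjacent, the value equals its own negative, hence is
  0.\<close>

lemma alternating_repeat_front:
  assumes "alternating c"
  shows "c (v # us @ v # ws) = 0"
  using assms
proof (induction us arbitrary: c)
  case Nil
  then show ?case using alternating_swap[of c v v ws] by simp
next
  case (Cons u us)
  have "c (v # u # us @ v # ws) = - c (u # v # us @ v # ws)"
    using alternating_swap[OF Cons.prems] .
  also have "\<dots> = 0"
    using Cons.IH[OF alternating_Cons[OF Cons.prems]] by simp
  finally show ?case by simp
qed

lemma alternating_not_distinct:
  assumes "alternating c" "\<not> distinct vs"
  shows "c vs = 0"
  using assms
proof (induction vs arbitrary: c)
  case (Cons v vs)
  show ?case
  proof (cases "v \<in> set vs")
    case True
    then obtain us ws where "vs = us @ v # ws" by (meson split_list)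
    then show ?thesis using alternating_repeat_front[OF Cons.prems(1)] by simp
  next
    case False
    then show ?thesis
      using Cons.IH[OF alternating_Cons[OF Cons.prems(1)]] Cons.prems(2) by simp
  qed
qed simp

lemma oriented_chains_mono: "K \<subseteq> L \<Longrightarrow> oriented_chains K n \<subseteq> oriented_chains L n"
  unfolding oriented_chains_def by blast

lemma oriented_chains_finite_support:
  "c \<in> oriented_chains K n \<Longrightarrow> finite (\<Union>(set ` {vs. c vs \<noteq> 0}))"
  using oriented_chainsD(1) by auto

section \<open>From acyclicity to trivial homology groups\<close>

lemma simplicial_boundary_uminus:
  "simplicial_boundary (\<lambda>vs. - c vs) vs = - simplicial_boundary c vs"
  unfolding simplicial_boundary_def by (simp add: sum_negf)

lemma simplicial_boundary_zero: "simplicial_boundary (\<lambda>vs. 0) vs = 0"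
  unfolding simplicial_boundary_def by simp

text \<open>Boundaries are cycles, so acyclicity makes both subgroups equal and leaves a single
  coset. Degree \<open>Suc k\<close> counts the vertices of a \<open>k\<close>-dimensional
  simplex.\<close>

lemma trivial_reduced_homology_group:
  assumes K: "\<forall>S\<in>K. \<forall>T\<subseteq>S. T \<in> K" and ac: "acyclic_at (Suc k) K"
  shows "trivial_group (reduced_homology_group k K)"
proof -
  define Z where "Z = {c \<in> oriented_chains K (Suc k). \<forall>vs. simplicial_boundary c vs = 0}"
  define B where "B = simplicial_boundary ` oriented_chains K (Suc (Suc k))"
  have ZB: "B = Z"
    using ac simplicial_boundary_boundary[OF K] simplicial_boundary_closed[OF K]
    unfolding acyclic_at_def B_def Z_def by blast
  have car: "carrier (cycle_group K (Suc k)) = Z"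
    by (auto simp: cycle_group_def kernel_def chain_group_def Z_def fun_eq_iff)
  have Zadd: "(\<lambda>vs. c vs + d vs) \<in> Z" if "c \<in> Z" "d \<in> Z" for c d
    using that by (auto simp: Z_def oriented_chains_add simplicial_boundary_add)
  have Zneg: "(\<lambda>vs. - c vs) \<in> Z" if "c \<in> Z" for c
    using that by (auto simp: Z_def oriented_chains_uminus simplicial_boundary_uminus)
  have coset: "Z #>\<^bsub>cycle_group K (Suc k)\<^esub> a = Z" if a: "a \<in> Z" for a
  proof
    show "Z #>\<^bsub>cycle_group K (Suc k)\<^esub> a \<subseteq> Z"
      using Zadd a by (auto simp: r_coset_def cycle_group_def chain_group_def)
    show "Z \<subseteq> Z #>\<^bsub>cycle_group K (Suc k)\<^esub> a"
    proof
      fix c assume "c \<in> Z"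
      then have "(\<lambda>vs. c vs + - a vs) \<in> Z" using Zadd[OF _ Zneg[OF a]] by blast
      then show "c \<in> Z #>\<^bsub>cycle_group K (Suc k)\<^esub> a"
        unfolding r_coset_def cycle_group_def chain_group_def
        by (auto intro!: bexI[of _ "\<lambda>vs. c vs + - a vs"])
    qed
  qed
  have Z0: "(\<lambda>vs. 0) \<in> Z"
    by (auto simp: Z_def oriented_chains_zero simplicial_boundary_zero)
  have eq: "reduced_homology_group k K = cycle_group K (Suc k) Mod Z"
    using ZB unfolding reduced_homology_group_def B_def by (simp add: chain_group_def)
  have "carrier (cycle_group K (Suc k) Mod Z) = {Z}"
    using coset Z0 by (auto simp: FactGroup_def RCOSETS_def car)
  then show ?thesis
    using comm_group_reduced_homology_group[OF K, of k]
    unfolding trivial_group_def eq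
    by (simp add: FactGroup_def comm_group.axioms)
qed

section \<open>Cones and vertex deletion\<close>

definition lk :: "'v set set \<Rightarrow> 'v \<Rightarrow> 'v set set" where
  "lk K v = {S. v \<notin> S \<and> insert v S \<in> K}"

text \<open>The cone of \<open>u\<close> with apex \<open>v\<close> has value \<open>u vs\<close> at \<open>v # vs\<close>; the other values
  follow from this by alternation.\<close>

primrec cone :: "'v \<Rightarrow> 'v list \<Rightarrow> ('v list \<Rightarrow> int) \<Rightarrow> int" where
  "cone v [] u = 0"
| "cone v (w # ws) u = (if w = v then u ws else - cone v ws (\<lambda>vs. u (w # vs)))"

lemma cone_nonzero: "cone v ws u \<noteq> 0 \<Longrightarrow> v \<in> set ws \<and> u (remove1 v ws) \<noteq> 0"
  by (induction ws arbitrary: u) (auto split: if_splits)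

lemma cone_uminus: "cone v ws (\<lambda>vs. - a vs) = - cone v ws a"
  by (induction ws arbitrary: a) auto

lemma cone_sum: "cone v ws (\<lambda>vs. \<Sum>x\<in>A. g x vs) = (\<Sum>x\<in>A. cone v ws (g x))"
  by (induction ws arbitrary: g) (auto simp: sum_negf)

text \<open>If exactly one of \<open>a\<close>, \<open>b\<close> is \<open>v\<close>, the swap moves
  \<open>v\<close> by one place and flips the sign built into \<open>cone\<close>. Vanishing of
  \<open>u\<close> on lists through \<open>v\<close> settles \<open>a = b = v\<close>.\<close>

lemma cone_swap:
  assumes "alternating u" "\<And>vs. v \<in> set vs \<Longrightarrow> u vs = 0"
  shows "cone v (us @ a # b # ws) u = - cone v (us @ b # a # ws) u"
  using assms
proof (induction us arbitrary: u)
  case Nil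
  have "u (a # b # vs) = - u (b # a # vs)" for vs
    using alternating_swap[OF Nil.prems(1)] .
  then show ?case using Nil.prems(2) by (auto simp: cone_uminus)
next
  case (Cons c us)
  show ?case
  proof (cases "c = v")
    case True
    then show ?thesis using alternatingD[OF Cons.prems(1), of us a b ws] by simp
  next
    case False
    then show ?thesis
      using Cons.IH[OF alternating_Cons[OF Cons.prems(1)]] Cons.prems(2) by simp
  qed
qed

text \<open>Moving \<open>v\<close> from the front to its place in \<open>ws\<close> passes exactly
  the entries that each contribute a sign in \<open>cone\<close>.\<close>

lemma cone_alternating_restore:
  assumes "alternating z" "distinct ws" "v \<in> set ws"
  shows "cone v ws (\<lambda>vs. z (v # vs)) = z ws"
  using assms
proof (induction ws arbitrary: z)
  case (Cons w ws)
  show ?case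
  proof (cases "w = v")
    case False
    have "cone v (w # ws) (\<lambda>vs. z (v # vs)) = cone v ws (\<lambda>vs. z (w # v # vs))"
      using False alternating_swap[OF Cons.prems(1), of v w] by (simp add: cone_uminus)
    also have "\<dots> = z (w # ws)"
      using Cons.IH[OF alternating_Cons[OF Cons.prems(1)]] Cons.prems False by simp
    finally show ?thesis .
  qed simp
qed simp

lemma lk_support:
  assumes "u \<in> oriented_chains (lk K v) n" "v \<in> set vs"
  shows "u vs = 0"
  using oriented_chainsD(2)[OF assms(1), of vs] assms(2) unfolding lk_def by blast

lemma cone_support:
  assumes "u \<in> oriented_chains (lk K v) n"
  shows "\<Union>(set ` {ws. cone v ws u \<noteq> 0}) \<subseteq> insert v (\<Union>(set ` {vs. u vs \<noteq> 0}))"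
proof
  fix x assume "x \<in> \<Union>(set ` {ws. cone v ws u \<noteq> 0})"
  then obtain ws where ws: "cone v ws u \<noteq> 0" "x \<in> set ws" by auto
  then show "x \<in> insert v (\<Union>(set ` {vs. u vs \<noteq> 0}))"
    using cone_nonzero[OF ws(1)] in_set_remove1[of x v ws] by auto
qed

lemma cone_chain:
  assumes "u \<in> oriented_chains (lk K v) n"
  shows "(\<lambda>ws. cone v ws u) \<in> oriented_chains K (Suc n)"
proof (rule oriented_chainsI)
  have dim: "length ws = Suc n \<and> distinct ws \<and> set ws \<in> K" if "cone v ws u \<noteq> 0" for ws
  proof -
    have v: "v \<in> set ws" and r: "u (remove1 v ws) \<noteq> 0" using cone_nonzero[OF that] by auto
    have *: "length (remove1 v ws) = n" "distinct (remove1 v ws)" "v \<notin> set (remove1 v ws)"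
      "insert v (set (remove1 v ws)) \<in> K"
      using oriented_chainsD(2)[OF assms r] unfolding lk_def by auto
    obtain us ws' where ws: "ws = us @ v # ws'" "v \<notin> set us"
      using split_list_first[OF v] by blast
    then have "remove1 v ws = us @ ws'" by (simp add: remove1_append)
    with * ws show ?thesis by auto
  qed
  then show "cone v ws u \<noteq> 0 \<Longrightarrow> length ws = Suc n \<and> distinct ws \<and> set ws \<in> K" for ws
    by blast
  let ?V = "insert v (\<Union>(set ` {vs. u vs \<noteq> 0}))"
  have "finite ?V" using oriented_chains_finite_support[OF assms] by simp
  moreover have "{ws. cone v ws u \<noteq> 0} \<subseteq> {ws. set ws \<subseteq> ?V \<and> length ws = Suc n}"
    using cone_support[OF assms] dim by blast
  ultimately show "finite {ws. cone v ws u \<noteq> 0}"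
    using finite_lists_length_eq[of ?V "Suc n"] by (meson finite_subset)
  show "cone v (us @ a # b # ws) u = - cone v (us @ b # a # ws) u" for us a b ws
    by (rule cone_swap[OF oriented_chains_alternating[OF assms] lk_support[OF assms]])
qed

text \<open>In the sum over a new first vertex \<open>w\<close>, the term \<open>w = v\<close>
  returns \<open>u\<close>; every other \<open>w\<close> gives minus the cone over a slice of
  \<open>u\<close>, and the slices add up to the boundary of \<open>u\<close>.\<close>

lemma cone_boundary:
  assumes "u \<in> oriented_chains (lk K v) n"
  shows "simplicial_boundary (\<lambda>ws. cone v ws u) ws = u ws - cone v ws (simplicial_boundary u)"
proof -
  let ?V = "\<Union>(set ` {vs. u vs \<noteq> 0})"
  have fin: "finite ?V" using oriented_chains_finite_support[OF assms] .
  have v: "v \<notin> ?V" using lk_support[OF assms] by auto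
  have "simplicial_boundary (\<lambda>ws. cone v ws u) ws = (\<Sum>w\<in>insert v ?V. cone v (w # ws) u)"
    using fin by (intro simplicial_boundary_eq'[OF cone_chain[OF assms]] cone_support[OF assms]) simp
  also have "\<dots> = u ws + (\<Sum>w\<in>?V. cone v (w # ws) u)"
    using fin v by simp
  also have "(\<Sum>w\<in>?V. cone v (w # ws) u) = (\<Sum>w\<in>?V. - cone v ws (\<lambda>vs. u (w # vs)))"
    using v by (intro sum.cong) auto
  also have "\<dots> = - cone v ws (\<lambda>vs. \<Sum>w\<in>?V. u (w # vs))"
    by (simp add: sum_negf cone_sum)
  also have "(\<lambda>vs. \<Sum>w\<in>?V. u (w # vs)) = simplicial_boundary u"
    using simplicial_boundary_eq[OF assms] by auto
  finally show ?thesis by simp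
qed

section \<open>Splitting a chain at a vertex\<close>

lemma link_part_chain:
  assumes "z \<in> oriented_chains K (Suc n)"
  shows "(\<lambda>vs. z (v # vs)) \<in> oriented_chains (lk K v) n"
proof (rule oriented_chainsI)
  have "{vs. z (v # vs) \<noteq> 0} \<subseteq> tl ` {vs. z vs \<noteq> 0}" by force
  then show "finite {vs. z (v # vs) \<noteq> 0}"
    using oriented_chainsD(1)[OF assms] by (meson finite_imageI finite_subset)
  show "length vs = n \<and> distinct vs \<and> set vs \<in> lk K v" if "z (v # vs) \<noteq> 0" for vs
    using oriented_chainsD(2)[OF assms that] by (auto simp: lk_def)
  show "z (v # us @ a # b # ws) = - z (v # us @ b # a # ws)" for us a b ws
    using alternatingD[OF alternating_Cons[OF oriented_chains_alternating[OF assms]]] .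
qed

lemma simplicial_boundary_link_part:
  assumes "z \<in> oriented_chains K n"
  shows "simplicial_boundary (\<lambda>vs. z (v # vs)) vs = - simplicial_boundary z (v # vs)"
proof -
  have *: "z (u # v # vs) = - z (v # u # vs)" for u
    using alternating_swap[OF oriented_chains_alternating[OF assms]] .
  show ?thesis unfolding simplicial_boundary_def * by (simp add: sum_negf)
qed

lemma avoiding_part_chain:
  assumes "z \<in> oriented_chains K n"
  shows "(\<lambda>vs. if v \<in> set vs then 0 else z vs) \<in> oriented_chains {S \<in> K. v \<notin> S} n"
proof (rule oriented_chainsI)
  show "finite {vs. (if v \<in> set vs then 0 else z vs) \<noteq> 0}"
    using oriented_chainsD(1)[OF assms] by (rule rev_finite_subset) auto
  show "length vs = n \<and> distinct vs \<and> set vs \<in> {S \<in> K. v \<notin> S}"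
    if "(if v \<in> set vs then 0 else z vs) \<noteq> 0" for vs
    using that oriented_chainsD(2)[OF assms, of vs] by (auto split: if_splits)
  show "(if v \<in> set (us @ a # b # ws) then 0 else z (us @ a # b # ws))
      = - (if v \<in> set (us @ b # a # ws) then 0 else z (us @ b # a # ws))" for us a b ws
    using oriented_chainsD(3)[OF assms, of us a b ws] by auto
qed

text \<open>On distinct lists through \<open>v\<close> the cone restores \<open>z\<close>. On lists
  through \<open>v\<close> with repetitions everything vanishes, as the slice at \<open>v\<close> is
  supported only where \<open>v # vs\<close> is distinct.\<close>

lemma chain_split:
  assumes "z \<in> oriented_chains K n"
  shows "z vs = (if v \<in> set vs then 0 else z vs) + cone v vs (\<lambda>vs. z (v # vs))"
proof (cases "v \<in> set vs")
  case True
  show ?thesis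
  proof (cases "distinct vs")
    case True
    then show ?thesis
      using cone_alternating_restore[OF oriented_chains_alternating[OF assms]] \<open>v \<in> set vs\<close> by simp
  next
    case False
    then have "z vs = 0"
      using alternating_not_distinct oriented_chains_alternating[OF assms] by blast
    moreover have "cone v vs (\<lambda>vs. z (v # vs)) = 0"
    proof (rule ccontr)
      assume nz: "cone v vs (\<lambda>vs. z (v # vs)) \<noteq> 0"
      then have "z (v # remove1 v vs) \<noteq> 0" using cone_nonzero[OF nz] by simp
      then have "distinct (v # remove1 v vs)" using oriented_chainsD(2)[OF assms] by blast
      moreover obtain us ws where "vs = us @ v # ws" "v \<notin> set us"
        using split_list_first[OF \<open>v \<in> set vs\<close>] by blast
      ultimately show False using False by (auto simp: remove1_append)
    qed
    ultimately show ?thesis using True by simp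
  qed
next
  case False
  then have "cone v vs (\<lambda>vs. z (v # vs)) = 0" using cone_nonzero by fastforce
  with False show ?thesis by simp
qed

text \<open>The cycle condition says that the part of \<open>z\<close> avoiding \<open>v\<close> has
  as boundary minus the slice of \<open>z\<close> at \<open>v\<close>. By
  \<open>cone_boundary\<close> and \<open>chain_split\<close>, the cone over that part then fills
  \<open>z\<close>.\<close>

lemma acyclic_at_cone:
  assumes apex: "\<And>S. S \<in> K \<Longrightarrow> insert v S \<in> K"
  shows "acyclic_at n K"
  unfolding acyclic_at_def
proof (intro ballI impI)
  fix z assume z: "z \<in> oriented_chains K n" and cyc: "\<forall>vs. simplicial_boundary z vs = 0"
  let ?z0 = "\<lambda>vs. if v \<in> set vs then 0 else z vs"
  let ?l = "\<lambda>vs. z (v # vs)"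
  have z0: "?z0 \<in> oriented_chains (lk K v) n"
    using avoiding_part_chain[OF z] oriented_chains_mono[of "{S \<in> K. v \<notin> S}" "lk K v" n] apex
    by (auto simp: lk_def)
  have "simplicial_boundary ?z0 vs = - z (v # vs)" for vs
  proof (cases "v \<in> set vs")
    case True
    then have "z (v # vs) = 0" using oriented_chainsD(2)[OF z, of "v # vs"] by auto
    with True show ?thesis by (simp add: simplicial_boundary_def)
  next
    case False
    let ?V = "insert v (\<Union>(set ` {vs. z vs \<noteq> 0}))"
    have fin: "finite ?V" using oriented_chains_finite_support[OF z] by simp
    have "simplicial_boundary ?z0 vs = (\<Sum>w\<in>?V. ?z0 (w # vs))"
      by (rule simplicial_boundary_eq'[OF z0 fin]) (auto split: if_splits)
    also have "\<dots> = (\<Sum>w\<in>?V - {v}. z (w # vs))"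
      using fin False by (subst sum.remove[of _ v]) (auto intro!: sum.cong split: if_splits)
    also have "\<dots> = (\<Sum>w\<in>?V. z (w # vs)) - z (v # vs)"
      using fin by (subst sum_diff1) auto
    also have "(\<Sum>w\<in>?V. z (w # vs)) = simplicial_boundary z vs"
      by (rule simplicial_boundary_eq'[OF z fin, symmetric]) auto
    finally show ?thesis using cyc by simp
  qed
  then have "simplicial_boundary ?z0 = (\<lambda>vs. - ?l vs)" by auto
  then have "simplicial_boundary (\<lambda>ws. cone v ws ?z0) ws = z ws" for ws
    using cone_boundary[OF z0, of ws] chain_split[OF z, of ws v] by (simp add: cone_uminus)
  then show "\<exists>d\<in>oriented_chains K (Suc n). simplicial_boundary d = z"
    using cone_chain[OF z0] by blast
qed

text \<open>A chain-level Mayer-Vietoris argument: the slice at \<open>v\<close> of a cycle is a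
  cycle of the link, one degree lower; coning a filling of it pushes the cycle into the deletion up
  to a boundary.\<close>

lemma acyclic_at_vertex_deletion:
  assumes K: "\<forall>S\<in>K. \<forall>T\<subseteq>S. T \<in> K"
    and del: "acyclic_at (Suc n) {S \<in> K. v \<notin> S}" and lk: "acyclic_at n (lk K v)"
  shows "acyclic_at (Suc n) K"
  unfolding acyclic_at_def
proof (intro ballI impI)
  fix z assume z: "z \<in> oriented_chains K (Suc n)" and cyc: "\<forall>vs. simplicial_boundary z vs = 0"
  let ?z0 = "\<lambda>vs. if v \<in> set vs then 0 else z vs"
  let ?l = "\<lambda>vs. z (v # vs)"
  let ?D = "{S \<in> K. v \<notin> S}"
  have "\<forall>vs. simplicial_boundary ?l vs = 0"
    using simplicial_boundary_link_part[OF z] cyc by simp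
  then obtain u where u: "u \<in> oriented_chains (lk K v) (Suc n)" and bu: "simplicial_boundary u = ?l"
    using lk link_part_chain[OF z] unfolding acyclic_at_def by blast
  have uD: "u \<in> oriented_chains ?D (Suc n)"
    using u oriented_chains_mono[of "lk K v" ?D] K unfolding lk_def by blast
  let ?C = "\<lambda>ws. cone v ws u"
  have C: "?C \<in> oriented_chains K (Suc (Suc n))" using cone_chain[OF u] .
  have bC: "simplicial_boundary ?C ws = u ws - cone v ws ?l" for ws
    using cone_boundary[OF u] bu by simp
  \<comment> \<open>In \<open>z\<close> plus the boundary of \<open>?C\<close>, the cones over the
    slice cancel by \<open>chain_split\<close> and \<open>bC\<close>; what remains avoids
    \<open>v\<close>.\<close>
  define y where "y = (\<lambda>vs. ?z0 vs + u vs)"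
  have y: "y \<in> oriented_chains ?D (Suc n)"
    unfolding y_def by (rule oriented_chains_add[OF avoiding_part_chain[OF z] uD])
  have y_eq: "y = (\<lambda>vs. z vs + simplicial_boundary ?C vs)"
  proof
    fix vs
    show "y vs = z vs + simplicial_boundary ?C vs"
      unfolding y_def bC using chain_split[OF z, of vs v] by linarith
  qed
  have "simplicial_boundary y vs = 0" for vs
    unfolding y_eq
    using simplicial_boundary_add[OF z simplicial_boundary_closed[OF K C]] cyc
      simplicial_boundary_boundary[OF K C] by simp
  then obtain d where d: "d \<in> oriented_chains ?D (Suc (Suc n))" and bd: "simplicial_boundary d = y"
    using del y unfolding acyclic_at_def by blast
  have dK: "d \<in> oriented_chains K (Suc (Suc n))"
    using d oriented_chains_mono[of ?D K] by blast
  have "simplicial_boundary (\<lambda>vs. d vs + - ?C vs) vs = z vs" for vs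
    using simplicial_boundary_add[OF dK oriented_chains_uminus[OF C]] bd y_eq
    by (simp add: simplicial_boundary_uminus)
  then show "\<exists>d\<in>oriented_chains K (Suc (Suc n)). simplicial_boundary d = z"
    using oriented_chains_add[OF dK oriented_chains_uminus[OF C]] by blast
qed

text \<open>Degree 0 has only the empty simplex, so it suffices to fill inside the cone
  \<open>{{}, {v}}\<close>.\<close>

lemma acyclic_at_0:
  assumes "{} \<in> K" "{v} \<in> K"
  shows "acyclic_at 0 K"
  unfolding acyclic_at_def
proof (intro ballI impI)
  fix c assume c: "c \<in> oriented_chains K 0" and cyc: "\<forall>vs. simplicial_boundary c vs = 0"
  have "c \<in> oriented_chains {{}, {v}} 0"
  proof (rule oriented_chainsI)
    show "length vs = 0 \<and> distinct vs \<and> set vs \<in> {{}, {v}}" if "c vs \<noteq> 0" for vs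
      using oriented_chainsD(2)[OF c that] by simp
  qed (rule oriented_chainsD(1)[OF c], rule oriented_chainsD(3)[OF c])
  moreover have "acyclic_at 0 {{}, {v}}"
    by (rule acyclic_at_cone[of _ v]) auto
  ultimately obtain d where "d \<in> oriented_chains {{}, {v}} (Suc 0)" "simplicial_boundary d = c"
    using cyc unfolding acyclic_at_def by blast
  then show "\<exists>d\<in>oriented_chains K (Suc 0). simplicial_boundary d = c"
    using oriented_chains_mono[of "{{}, {v}}" K] assms by blast
qed

lemma not_acyclic_at_simplex:
  assumes "\<not> acyclic_at n K"
  obtains vs where "length vs = n" "distinct vs" "set vs \<in> K"
proof -
  obtain c where c: "c \<in> oriented_chains K n"
    and no: "\<not> (\<exists>d\<in>oriented_chains K (Suc n). simplicial_boundary d = c)"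
    using assms unfolding acyclic_at_def by blast
  have "c \<noteq> (\<lambda>vs. 0)"
    using no oriented_chains_zero[of K "Suc n"] simplicial_boundary_zero by blast
  then obtain vs where "c vs \<noteq> 0" by auto
  then show thesis using oriented_chainsD(2)[OF c] that by blast
qed

section \<open>Simplicial maps\<close>

text \<open>The value of the pushforward of \<open>c\<close> along \<open>f\<close> at \<open>ws\<close> is the sum of \<open>c vs\<close> over
  all lists \<open>vs\<close> in \<open>V\<close> with \<open>map f vs = ws\<close>. Degenerate images need no special
  treatment, as alternation makes them cancel.\<close>

primrec push :: "'v set \<Rightarrow> ('v \<Rightarrow> 'w) \<Rightarrow> 'w list \<Rightarrow> ('v list \<Rightarrow> int) \<Rightarrow> int" where
  "push V f [] c = c []"
| "push V f (w # ws) c = push V f ws (\<lambda>vs. \<Sum>v | v \<in> V \<and> f v = w. c (v # vs))"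

lemma push_uminus: "push V f ws (\<lambda>vs. - c vs) = - push V f ws c"
  by (induction ws arbitrary: c) (auto simp: sum_negf)

lemma push_sum: "push V f ws (\<lambda>vs. \<Sum>x\<in>A. g x vs) = (\<Sum>x\<in>A. push V f ws (g x))"
proof (induction ws arbitrary: g)
  case (Cons w ws)
  have "(\<lambda>vs. \<Sum>v | v \<in> V \<and> f v = w. \<Sum>x\<in>A. g x (v # vs))
      = (\<lambda>vs. \<Sum>x\<in>A. \<Sum>v | v \<in> V \<and> f v = w. g x (v # vs))"
    by (rule ext, rule sum.swap)
  then show ?case using Cons by simp
qed simp

lemma push_nonzero: "push V f ws c \<noteq> 0 \<Longrightarrow> \<exists>vs. map f vs = ws \<and> c vs \<noteq> 0"
proof (induction ws arbitrary: c)
  case (Cons w ws)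
  then obtain vs where vs: "map f vs = ws" "(\<Sum>v | v \<in> V \<and> f v = w. c (v # vs)) \<noteq> 0"
    by fastforce
  then obtain v where "f v = w" "c (v # vs) \<noteq> 0"
    by (metis (mono_tags, lifting) mem_Collect_eq sum.neutral)
  with vs show ?case by (intro exI[of _ "v # vs"]) simp
qed simp

lemma push_swap:
  assumes "alternating c"
  shows "push V f (us @ a # b # ws) c = - push V f (us @ b # a # ws) c"
  using assms
proof (induction us arbitrary: c)
  case Nil
  have "(\<lambda>vs. \<Sum>u | u \<in> V \<and> f u = b. \<Sum>v | v \<in> V \<and> f v = a. c (v # u # vs))
      = (\<lambda>vs. - (\<Sum>v | v \<in> V \<and> f v = a. \<Sum>u | u \<in> V \<and> f u = b. c (u # v # vs)))"
    (is "?l = ?r")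
  proof
    fix vs
    have "?l vs = (\<Sum>v | v \<in> V \<and> f v = a. \<Sum>u | u \<in> V \<and> f u = b. c (v # u # vs))"
      by (rule sum.swap)
    also have "\<dots> = ?r vs"
      unfolding sum_negf[symmetric] by (intro sum.cong refl alternating_swap[OF Nil])
    finally show "?l vs = ?r vs" .
  qed
  then show ?case by (simp add: push_uminus)
next
  case (Cons x us)
  then show ?case by (simp add: alternating_sum alternating_Cons)
qed

lemma push_alternating:
  assumes "alternating c"
  shows "alternating (\<lambda>ws. push V f ws c)"
  unfolding alternating_def by (intro allI push_swap[OF assms])

lemma push_chain:
  assumes c: "c \<in> oriented_chains K n" and f: "\<And>S. S \<in> K \<Longrightarrow> f ` S \<in> L"
  shows "(\<lambda>ws. push V f ws c) \<in> oriented_chains L n"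
proof (rule oriented_chainsI)
  have "{ws. push V f ws c \<noteq> 0} \<subseteq> map f ` {vs. c vs \<noteq> 0}"
    using push_nonzero by fastforce
  then show "finite {ws. push V f ws c \<noteq> 0}"
    using oriented_chainsD(1)[OF c] by (meson finite_imageI finite_subset)
  show "push V f (us @ a # b # ws) c = - push V f (us @ b # a # ws) c" for us a b ws
    by (rule push_swap[OF oriented_chains_alternating[OF c]])
  fix ws assume nz: "push V f ws c \<noteq> 0"
  then have "distinct ws"
    using alternating_not_distinct[OF push_alternating[OF oriented_chains_alternating[OF c]]] by blast
  moreover obtain vs where "map f vs = ws" "c vs \<noteq> 0" using push_nonzero[OF nz] by blast
  ultimately show "length ws = n \<and> distinct ws \<and> set ws \<in> L"
    using oriented_chainsD(2)[OF c, of vs] f by auto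
qed

text \<open>Grouping \<open>V\<close> into the fibres of \<open>f\<close> turns the sum over first
  vertices in the image into the sum over first vertices in \<open>V\<close>.\<close>

lemma push_boundary:
  assumes c: "c \<in> oriented_chains K n" and f: "\<And>S. S \<in> K \<Longrightarrow> f ` S \<in> L"
    and V: "finite V" "\<Union>K \<subseteq> V"
  shows "simplicial_boundary (\<lambda>ws. push V f ws c) ws = push V f ws (simplicial_boundary c)"
proof -
  have suppV: "set vs \<subseteq> V" if "c vs \<noteq> 0" for vs
    using oriented_chainsD(2)[OF c that] V(2) by blast
  have supp: "\<Union>(set ` {vs. c vs \<noteq> 0}) \<subseteq> V" using suppV by blast
  have "\<Union>(set ` {ws. push V f ws c \<noteq> 0}) \<subseteq> f ` V"
  proof safe
    fix x ws assume "push V f ws c \<noteq> 0" "x \<in> set ws"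
    then show "x \<in> f ` V" using push_nonzero[of V f ws c] suppV by fastforce
  qed
  then have "simplicial_boundary (\<lambda>ws. push V f ws c) ws = (\<Sum>w\<in>f ` V. push V f (w # ws) c)"
    using V(1) by (intro simplicial_boundary_eq'[OF push_chain[OF c f]]) auto
  also have "\<dots> = push V f ws (\<lambda>vs. \<Sum>w\<in>f ` V. \<Sum>v | v \<in> V \<and> f v = w. c (v # vs))"
    by (simp add: push_sum)
  also have "(\<lambda>vs. \<Sum>w\<in>f ` V. \<Sum>v | v \<in> V \<and> f v = w. c (v # vs)) = (\<lambda>vs. \<Sum>v\<in>V. c (v # vs))"
    using V(1) by (intro ext sum.group) auto
  also have "\<dots> = simplicial_boundary c"
    using simplicial_boundary_eq'[OF c V(1) supp] by auto
  finally show ?thesis .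
qed

lemma push_push:
  assumes "finite V" "finite W" "f ` V \<subseteq> W"
  shows "push W r xs (\<lambda>ws. push V f ws c) = push V (r \<circ> f) xs c"
proof (induction xs arbitrary: c)
  case (Cons x xs)
  have "(\<Sum>w | w \<in> W \<and> r w = x. \<Sum>v | v \<in> V \<and> f v = w. c (v # vs))
      = (\<Sum>v | v \<in> V \<and> (r \<circ> f) v = x. c (v # vs))" for vs
  proof -
    let ?A = "{v. v \<in> V \<and> (r \<circ> f) v = x}" and ?B = "{w. w \<in> W \<and> r w = x}"
    have "(\<Sum>w\<in>?B. \<Sum>v | v \<in> V \<and> f v = w. c (v # vs))
        = (\<Sum>w\<in>?B. \<Sum>v | v \<in> ?A \<and> f v = w. c (v # vs))"
      by (intro sum.cong) auto
    also have "\<dots> = (\<Sum>v\<in>?A. c (v # vs))"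
      using assms by (intro sum.group) auto
    finally show ?thesis .
  qed
  then show ?case
    using Cons.IH[of "\<lambda>vs. \<Sum>v | v \<in> V \<and> (r \<circ> f) v = x. c (v # vs)"]
    by (simp flip: push_sum)
qed simp

lemma push_ident:
  assumes "\<And>v. v \<in> V \<Longrightarrow> h v = v" "\<And>vs. c vs \<noteq> 0 \<Longrightarrow> set vs \<subseteq> V"
  shows "push V h vs c = c vs"
  using assms(2)
proof (induction vs arbitrary: c)
  case (Cons w ws)
  have "{v. v \<in> V \<and> h v = w} = (if w \<in> V then {w} else {})"
    using assms(1) by auto
  then have "(\<lambda>vs. \<Sum>v | v \<in> V \<and> h v = w. c (v # vs)) = (\<lambda>vs. c (w # vs))"
    using Cons.prems by fastforce
  then show ?case using Cons.IH[of "\<lambda>vs. c (w # vs)"] Cons.prems by force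
qed simp

text \<open>Push a cycle to \<open>L\<close>, fill it there and push the filling back:
  \<open>r\<close> after \<open>f\<close> fixes \<open>V\<close>, so the result fills the original
  cycle.\<close>

lemma acyclic_at_retract:
  assumes f: "\<And>S. S \<in> K \<Longrightarrow> f ` S \<in> L" and r: "\<And>S. S \<in> L \<Longrightarrow> r ` S \<in> K"
    and rf: "\<And>v. v \<in> V \<Longrightarrow> r (f v) = v"
    and V: "finite V" "\<Union>K \<subseteq> V" and W: "finite W" "\<Union>L \<subseteq> W" "f ` V \<subseteq> W"
    and L: "acyclic_at n L"
  shows "acyclic_at n K"
  unfolding acyclic_at_def
proof (intro ballI impI)
  fix z assume z: "z \<in> oriented_chains K n" and cyc: "\<forall>vs. simplicial_boundary z vs = 0"
  have "simplicial_boundary z = (\<lambda>vs. 0)" using cyc by auto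
  then have "simplicial_boundary (\<lambda>ws. push V f ws z) ws = 0" for ws
    using push_boundary[OF z f V, of ws] push_nonzero[of V f ws "\<lambda>vs. 0"] by auto
  then obtain d where d: "d \<in> oriented_chains L (Suc n)"
    and bd: "simplicial_boundary d = (\<lambda>ws. push V f ws z)"
    using L push_chain[OF z f] unfolding acyclic_at_def by blast
  have "simplicial_boundary (\<lambda>vs. push W r vs d) vs = z vs" for vs
  proof -
    have "simplicial_boundary (\<lambda>vs. push W r vs d) vs = push V (r \<circ> f) vs z"
      using push_boundary[OF d r W(1,2)] bd push_push[OF V(1) W(1,3)] by simp
    also have "\<dots> = z vs"
      using rf oriented_chainsD(2)[OF z] V(2) by (intro push_ident) (simp, blast)
    finally show ?thesis .
  qed
  then show "\<exists>d\<in>oriented_chains K (Suc n). simplicial_boundary d = z"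
    using push_chain[OF d r] by blast
qed

section \<open>Order complexes\<close>

lemma order_complex_subset: "\<forall>S\<in>order_complex ord P. \<forall>T\<subseteq>S. T \<in> order_complex ord P"
  by (auto simp: order_complex_def Complete_Partial_Order.chain_def intro: finite_subset)

lemma order_complex_converse: "order_complex (\<lambda>a b. ord b a) P = order_complex ord P"
  by (auto simp: order_complex_def Complete_Partial_Order.chain_def)

lemma order_complex_deletion:
  "{S \<in> order_complex ord P. v \<notin> S} = order_complex ord (P - {v})"
  by (auto simp: order_complex_def)

lemma lk_order_complex:
  assumes "v \<in> P" "ord v v"
  shows "lk (order_complex ord P) v = order_complex ord {p \<in> P - {v}. ord p v \<or> ord v p}"
  using assms by (auto simp: lk_def order_complex_def Complete_Partial_Order.chain_def)

lemma acyclic_at_order_complex_apex: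
  assumes "a \<in> P" "\<And>p. p \<in> P \<Longrightarrow> ord a p \<or> ord p a"
  shows "acyclic_at n (order_complex ord P)"
  by (rule acyclic_at_cone[of _ a])
    (use assms in \<open>auto simp: order_complex_def Complete_Partial_Order.chain_def\<close>)

lemma acyclic_at_order_complex_deletion:
  assumes "v \<in> P" "ord v v" "acyclic_at (Suc n) (order_complex ord (P - {v}))"
    "acyclic_at n (order_complex ord {p \<in> P - {v}. ord p v \<or> ord v p})"
  shows "acyclic_at (Suc n) (order_complex ord P)"
  using acyclic_at_vertex_deletion[OF order_complex_subset[of ord P], where v = v]
    assms by (simp add: order_complex_deletion lk_order_complex)

text \<open>The elements outside \<open>Q\<close> are removed one at a time, maximal ones first; the link of
  \<open>p\<close> is then a cone with apex \<open>f p\<close>.\<close>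

lemma acyclic_at_order_complex_reflective:
  assumes ord: "\<And>a. ord a a" "transp ord" "antisymp ord"
    and P: "finite P" "Q \<subseteq> P"
    and f: "\<And>p. p \<in> P - Q \<Longrightarrow> f p \<in> Q \<and> ord p (f p)"
      "\<And>p q. p \<in> P - Q \<Longrightarrow> q \<in> Q \<Longrightarrow> ord p q \<Longrightarrow> ord (f p) q"
    and Q: "acyclic_at (Suc n) (order_complex ord Q)"
  shows "acyclic_at (Suc n) (order_complex ord P)"
  using P f
proof (induction "card (P - Q)" arbitrary: P)
  case 0
  then show ?case using Q by (metis Diff_eq_empty_iff card_0_eq finite_Diff subset_antisym)
next
  case (Suc k)
  let ?lt = "\<lambda>a b. ord a b \<and> a \<noteq> b"
  have "finite (P - Q)" using Suc.prems(1) by simp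
  moreover have "P - Q \<noteq> {}" using Suc.hyps(2) by (metis card.empty nat.simps(3))
  moreover have "asymp_on (P - Q) ?lt" "transp_on (P - Q) ?lt"
    using ord unfolding asymp_on_def transp_on_def antisymp_on_def by blast+
  ultimately obtain p where p: "p \<in> P - Q" and max: "\<And>x. x \<in> P - Q \<Longrightarrow> \<not> ?lt p x"
    using Finite_Set.bex_max_element[of "P - Q" ?lt] by metis
  have "k = card (P - {p} - Q)"
    using Suc.hyps(2) p Suc.prems(1) by (metis Diff_insert Diff_insert2 card_Diff_singleton diff_Suc_1)
  then have "acyclic_at (Suc n) (order_complex ord (P - {p}))"
    using Suc.prems p by (intro Suc.hyps(1)) auto
  moreover have "acyclic_at n (order_complex ord {x \<in> P - {p}. ord x p \<or> ord p x})"
  proof (rule acyclic_at_order_complex_apex)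
    have fp: "f p \<in> Q" "ord p (f p)" using Suc.prems(3)[OF p] by auto
    then show "f p \<in> {x \<in> P - {p}. ord x p \<or> ord p x}" using p Suc.prems(2) by auto
    fix x assume x: "x \<in> {x \<in> P - {p}. ord x p \<or> ord p x}"
    show "ord (f p) x \<or> ord x (f p)"
    proof (cases "ord x p")
      case True
      then show ?thesis using fp(2) ord(2) by (meson transpD)
    next
      case False
      \<comment> \<open>By maximality of \<open>p\<close>, nothing in \<open>P - Q\<close> lies
        strictly above it.\<close>
      then have "x \<in> Q" "ord p x" using x max by auto
      then show ?thesis using Suc.prems(4)[OF p] by blast
    qed
  qed
  ultimately show ?case
    using acyclic_at_order_complex_deletion[of p P ord n] p ord(1) by blast
qed

section \<open>Intervals of faces and shrinking sequences\<close>

text \<open>If \<open>B\<close> is a face disjoint from \<open>\<Gamma>\<close> and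
  \<open>psi X R (B \<union> \<Gamma>) = \<sigma>\<close>, the order complex is the barycentric
  subdivision of the link of \<open>B\<close> in the complex of faces inside
  \<open>B \<union> \<Gamma>\<close>.\<close>

definition face_interval :: "'a set \<Rightarrow> ('a \<times> 'b) set \<Rightarrow> 'a set \<Rightarrow> 'b set \<Rightarrow> 'b set \<Rightarrow> 'b set set" where
  "face_interval X R \<sigma> B \<Gamma> = {A. B \<subset> A \<and> A \<subseteq> B \<union> \<Gamma> \<and> psi X R A \<noteq> \<sigma>}"

text \<open>The accumulator \<open>B\<close> follows the passage from \<open>B\<close> to
  \<open>insert y B\<close> that occurs when taking links.\<close>

primrec shrinking :: "'a set \<Rightarrow> ('a \<times> 'b) set \<Rightarrow> 'b set \<Rightarrow> 'b list \<Rightarrow> bool" where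
  "shrinking X R B [] \<longleftrightarrow> True"
| "shrinking X R B (y # ys) \<longleftrightarrow>
     psi X R (insert y B) \<noteq> psi X R B \<and> shrinking X R (insert y B) ys"

definition shrinking_sequences ::
    "'a set \<Rightarrow> ('a \<times> 'b) set \<Rightarrow> 'a set \<Rightarrow> 'b set \<Rightarrow> 'b set \<Rightarrow> nat \<Rightarrow> 'b list set" where
  "shrinking_sequences X R \<sigma> B \<Gamma> n =
     {ys. set ys \<subseteq> \<Gamma> \<and> distinct ys \<and> shrinking X R B ys \<and> psi X R (B \<union> set ys) = \<sigma> \<and> n \<le> length ys}"

lemma psi_antimono: "A \<subseteq> B \<Longrightarrow> psi X R B \<subseteq> psi X R A"
  by (auto simp: psi_def)

lemma subset_psi_phi: "S \<subseteq> X \<Longrightarrow> S \<subseteq> psi X R (phi Y R S)"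
  by (auto simp: psi_def phi_def attributes_of_def individuals_with_def)

lemma psi_insert: "psi X R (insert y B) = psi X R B \<inter> individuals_with X R y"
  by (auto simp: psi_def)

lemma finite_shrinking_sequences:
  assumes "finite \<Gamma>"
  shows "finite (shrinking_sequences X R \<sigma> B \<Gamma> n)"
proof (rule finite_subset)
  show "shrinking_sequences X R \<sigma> B \<Gamma> n \<subseteq> {ys. set ys \<subseteq> \<Gamma> \<and> distinct ys}"
    by (auto simp: shrinking_sequences_def)
  show "finite {ys. set ys \<subseteq> \<Gamma> \<and> distinct ys}"
    using finite_subset_distinct[OF assms] by simp
qed

section \<open>Acyclicity of face intervals\<close>

lemma finite_face_interval:
  assumes "finite \<Gamma>" "finite B"
  shows "finite (face_interval X R \<sigma> B \<Gamma>)"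
  by (rule finite_subset[of _ "Pow (B \<union> \<Gamma>)"]) (use assms in \<open>auto simp: face_interval_def\<close>)

text \<open>Members of a chain are told apart by the size of \<open>A - B\<close>, which is positive
  since \<open>B\<close> is excluded and below \<open>card \<Gamma>\<close> since
  \<open>B \<union> \<Gamma>\<close> is not a face.\<close>

lemma face_interval_simplex_length:
  assumes fin: "finite \<Gamma>" and top: "psi X R (B \<union> \<Gamma>) = \<sigma>"
    and vs: "distinct vs" "set vs \<in> order_complex (\<subseteq>) (face_interval X R \<sigma> B \<Gamma>)"
    and "\<Gamma> \<noteq> {}"
  shows "length vs < card \<Gamma>"
proof -
  have F: "A \<subseteq> B \<union> \<Gamma>" "B \<subset> A" "A \<noteq> B \<union> \<Gamma>" if "A \<in> set vs" for A
  proof -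
    have "A \<in> face_interval X R \<sigma> B \<Gamma>" using vs(2) that by (auto simp: order_complex_def)
    then show "A \<subseteq> B \<union> \<Gamma>" "B \<subset> A" "A \<noteq> B \<union> \<Gamma>" using top by (auto simp: face_interval_def)
  qed
  have chain: "A \<subseteq> A' \<or> A' \<subseteq> A" if "A \<in> set vs" "A' \<in> set vs" for A A'
    using vs(2) that unfolding order_complex_def Complete_Partial_Order.chain_def by blast
  let ?h = "\<lambda>A. card (A - B)"
  have sub: "A - B \<subset> \<Gamma>" "A - B \<noteq> {}" if "A \<in> set vs" for A
    using F[OF that] by auto
  then have fin': "finite (A - B)" if "A \<in> set vs" for A
    using fin that by (meson finite_subset psubset_imp_subset)
  have inj: "inj_on ?h (set vs)"
  proof (rule inj_onI)
    fix A A' assume A: "A \<in> set vs" "A' \<in> set vs" "?h A = ?h A'"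
    have "A - B = A' - B"
      using chain[OF A(1,2)] A(3) fin'[OF A(1)] fin'[OF A(2)]
      by (metis Diff_mono card_subset_eq order_refl)
    then show "A = A'" using F(2)[OF A(1)] F(2)[OF A(2)] by auto
  qed
  have "?h A \<in> {1..<card \<Gamma>}" if "A \<in> set vs" for A
    using sub[OF that] fin psubset_card_mono[of \<Gamma> "A - B"] fin'[OF that] card_gt_0_iff[of "A - B"]
    by auto
  then have "card (set vs) \<le> card {1..<card \<Gamma>}"
    using inj by (intro card_inj_on_le[of ?h]) auto
  moreover have "card \<Gamma> > 0" using fin \<open>\<Gamma> \<noteq> {}\<close> by auto
  ultimately show ?thesis using distinct_card[OF vs(1)] by simp
qed

text \<open>Here \<open>B \<union> \<Gamma>\<close> is the greatest element, unless
  \<open>\<Gamma>\<close> is empty; then no simplex has \<open>Suc n\<close> vertices.\<close>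

lemma acyclic_at_face_interval_top:
  assumes "psi X R (B \<union> \<Gamma>) \<noteq> \<sigma>" "B \<inter> \<Gamma> = {}"
  shows "acyclic_at (Suc n) (order_complex (\<subseteq>) (face_interval X R \<sigma> B \<Gamma>))"
proof (cases "\<Gamma> = {}")
  case True
  then have "face_interval X R \<sigma> B \<Gamma> = {}" by (auto simp: face_interval_def)
  then show ?thesis
    by (rule_tac ccontr, erule_tac not_acyclic_at_simplex) (auto simp: order_complex_def)
next
  case False
  with assms show ?thesis
    by (intro acyclic_at_order_complex_apex[of "B \<union> \<Gamma>"]) (auto simp: face_interval_def)
qed

lemma acyclic_at_face_interval_uninformative:
  assumes fin: "finite \<Gamma>" "finite B" and y: "y \<in> \<Gamma>" "y \<notin> B"
    and B: "psi X R B \<noteq> \<sigma>" and eq: "psi X R (insert y B) = psi X R B"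
  shows "acyclic_at (Suc n) (order_complex (\<subseteq>) (face_interval X R \<sigma> B \<Gamma>))"
proof (rule acyclic_at_order_complex_reflective[where f = "insert y"])
  let ?F = "face_interval X R \<sigma> B \<Gamma>"
  let ?Q = "{A \<in> ?F. y \<in> A}"
  show "acyclic_at (Suc n) (order_complex (\<subseteq>) ?Q)"
    \<comment> \<open>Among the faces containing \<open>y\<close>, \<open>insert y B\<close> is the
      least.\<close>
    by (rule acyclic_at_order_complex_apex[of "insert y B"])
      (use y B eq in \<open>auto simp: face_interval_def\<close>)
  fix A assume A: "A \<in> ?F - ?Q"
  \<comment> \<open>\<open>psi X R A\<close> lies in \<open>psi X R B\<close>, all of whose
    individuals have \<open>y\<close> by \<open>eq\<close>.\<close>
  have "psi X R (insert y A) = psi X R A"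
    using A eq psi_antimono[of B A X R] unfolding psi_insert face_interval_def by blast
  then show "insert y A \<in> ?Q \<and> A \<subseteq> insert y A"
    using A y(1) unfolding face_interval_def by auto
qed (use finite_face_interval[OF fin] in \<open>auto simp: transp_def antisymp_def\<close>)

text \<open>If \<open>insert y B\<close> is a face, nothing in the interval lies strictly below it,
  so its link is the interval above it; after its deletion, removing \<open>y\<close> from faces
  retracts onto the interval for \<open>\<Gamma> - {y}\<close>.\<close>

lemma acyclic_at_face_interval_step:
  assumes fin: "finite \<Gamma>" "finite B" and disj: "B \<inter> \<Gamma> = {}" and y: "y \<in> \<Gamma>"
    and \<sigma>: "psi X R (B \<union> \<Gamma>) = \<sigma>"
    and link: "psi X R (insert y B) = \<sigma> \<or>
      acyclic_at n (order_complex (\<subseteq>) (face_interval X R \<sigma> (insert y B) (\<Gamma> - {y})))"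
    and del: "acyclic_at (Suc n) (order_complex (\<subseteq>) (face_interval X R \<sigma> B (\<Gamma> - {y})))"
  shows "acyclic_at (Suc n) (order_complex (\<subseteq>) (face_interval X R \<sigma> B \<Gamma>))"
proof -
  let ?F = "face_interval X R \<sigma> B \<Gamma>"
  let ?Q = "face_interval X R \<sigma> B (\<Gamma> - {y})"
  let ?v = "insert y B"
  \<comment> \<open>On subsets of \<open>B \<union> \<Gamma>\<close> the value
    \<open>\<sigma>\<close> is the least one, so enlarging a non-face gives a non-face.\<close>
  have below: "psi X R A = \<sigma>" if "psi X R A' = \<sigma>" "A' \<subseteq> A" "A \<subseteq> B \<union> \<Gamma>" for A A'
    using that psi_antimono[of A' A X R] psi_antimono[of A "B \<union> \<Gamma>" X R] \<sigma> by auto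
  show ?thesis
  proof (cases "psi X R (insert y B) = \<sigma>")
    case True
    have "y \<notin> A" if "A \<in> ?F" for A
      using below[OF True, of A] that unfolding face_interval_def by auto
    then have "?F = ?Q" unfolding face_interval_def by blast
    then show ?thesis using del by simp
  next
    case False
    have yB: "y \<notin> B" using disj y by auto
    \<comment> \<open>Removing \<open>y\<close> lowers a face, hence the reversed order. With
      \<open>insert y B\<close> deleted, \<open>A - {y}\<close> never equals
      \<open>B\<close>.\<close>
    have "acyclic_at (Suc n) (order_complex (\<lambda>a b. b \<subseteq> a) (?F - {?v}))"
    proof (rule acyclic_at_order_complex_reflective[where f = "\<lambda>A. A - {y}" and Q = ?Q])
      show "acyclic_at (Suc n) (order_complex (\<lambda>a b. b \<subseteq> a) ?Q)"
        using del order_complex_converse[of "(\<subseteq>)" ?Q] by simp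
      show "?Q \<subseteq> ?F - {?v}" using yB by (auto simp: face_interval_def)
      fix A assume A: "A \<in> ?F - {?v} - ?Q"
      have "psi X R (A - {y}) \<noteq> \<sigma>"
        using below[of "A - {y}" A] A unfolding face_interval_def by auto
      then show "A - {y} \<in> ?Q \<and> A - {y} \<subseteq> A"
        using A yB unfolding face_interval_def by auto
      fix q assume "q \<in> ?Q" "q \<subseteq> A"
      then show "q \<subseteq> A - {y}" using yB unfolding face_interval_def by auto
    qed (use finite_face_interval[OF fin] in \<open>auto simp: transp_def antisymp_def\<close>)
    then have "acyclic_at (Suc n) (order_complex (\<subseteq>) (?F - {?v}))"
      using order_complex_converse[of "(\<subseteq>)" "?F - {?v}"] by simp
    moreover have "{p \<in> ?F - {?v}. p \<subseteq> ?v \<or> ?v \<subseteq> p} = face_interval X R \<sigma> ?v (\<Gamma> - {y})"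
      using y yB unfolding face_interval_def by auto
    moreover have "?v \<in> ?F" using y yB False unfolding face_interval_def by auto
    ultimately show ?thesis
      using acyclic_at_order_complex_deletion[of ?v ?F "(\<subseteq>)" n] link False by simp
  qed
qed

section \<open>Counting shrinking sequences\<close>

lemma shrinking_sequences_Cons:
  assumes "y \<in> \<Gamma>" "psi X R (insert y B) \<noteq> psi X R B"
    and "ys \<in> shrinking_sequences X R \<sigma> (insert y B) (\<Gamma> - {y}) n"
  shows "y # ys \<in> shrinking_sequences X R \<sigma> B \<Gamma> (Suc n)"
  using assms by (auto simp: shrinking_sequences_def)

lemma card_shrinking_sequences:
  assumes "finite \<Gamma>" "finite B" "B \<inter> \<Gamma> = {}" "psi X R B \<noteq> \<sigma>" "psi X R (B \<union> \<Gamma>) = \<sigma>"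
    and "\<not> acyclic_at n (order_complex (\<subseteq>) (face_interval X R \<sigma> B \<Gamma>))"
  shows "fact (Suc n) \<le> card (shrinking_sequences X R \<sigma> B \<Gamma> (Suc n))"
  using assms
proof (induction "card \<Gamma>" arbitrary: \<Gamma> B n rule: less_induct)
  case less
  let ?F = "face_interval X R \<sigma> B \<Gamma>"
  have \<Gamma>: "\<Gamma> \<noteq> {}" using less.prems by auto
  show ?case
  proof (cases n)
    case 0
    \<comment> \<open>In degree 0 a single vertex suffices for acyclicity. With no face in the
      interval, releasing any one attribute of \<open>\<Gamma>\<close> already reaches
      \<open>\<sigma>\<close>.\<close>
    have "?F = {}"
    proof (rule ccontr)
      assume "?F \<noteq> {}"
      then obtain A where "A \<in> ?F" by blast
      then have "acyclic_at 0 (order_complex (\<subseteq>) ?F)"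
        by (intro acyclic_at_0[of _ A]) (auto simp: order_complex_def Complete_Partial_Order.chain_def)
      then show False using less.prems(6) 0 by simp
    qed
    moreover obtain y where y: "y \<in> \<Gamma>" using \<Gamma> by blast
    moreover have "B \<subset> insert y B" "insert y B \<subseteq> B \<union> \<Gamma>" using y less.prems(3) by auto
    ultimately have "psi X R (insert y B) = \<sigma>"
      unfolding face_interval_def by blast
    then have "[y] \<in> shrinking_sequences X R \<sigma> B \<Gamma> (Suc n)"
      using y less.prems(4) 0 by (simp add: shrinking_sequences_def)
    then have "card (shrinking_sequences X R \<sigma> B \<Gamma> (Suc n)) > 0"
      using finite_shrinking_sequences[OF less.prems(1)] by (metis card_gt_0_iff empty_iff)
    then show ?thesis using 0 by simp
  next
    case (Suc m)
    let ?S = "\<lambda>y. shrinking_sequences X R \<sigma> (insert y B) (\<Gamma> - {y}) n"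
    show ?thesis
    proof (cases "\<exists>y\<in>\<Gamma>. psi X R (insert y B) = \<sigma> \<or>
        acyclic_at m (order_complex (\<subseteq>) (face_interval X R \<sigma> (insert y B) (\<Gamma> - {y})))")
      case True
      then obtain y where y: "y \<in> \<Gamma>" and link: "psi X R (insert y B) = \<sigma> \<or>
          acyclic_at m (order_complex (\<subseteq>) (face_interval X R \<sigma> (insert y B) (\<Gamma> - {y})))"
        by blast
      have na: "\<not> acyclic_at n (order_complex (\<subseteq>) (face_interval X R \<sigma> B (\<Gamma> - {y})))"
        using acyclic_at_face_interval_step[OF less.prems(1-3) y less.prems(5) link] less.prems(6)
          Suc by blast
      have disj: "B \<inter> (\<Gamma> - {y}) = {}" using less.prems(3) by auto
      \<comment> \<open>Otherwise \<open>B \<union> (\<Gamma> - {y})\<close> would be a face and the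
        smaller interval acyclic.\<close>
      moreover have "psi X R (B \<union> (\<Gamma> - {y})) = \<sigma>"
      proof (rule ccontr)
        assume "psi X R (B \<union> (\<Gamma> - {y})) \<noteq> \<sigma>"
        from acyclic_at_face_interval_top[OF this disj, of m] show False using na Suc by simp
      qed
      moreover have "card (\<Gamma> - {y}) < card \<Gamma>"
        using y less.prems(1) by (rule card_Diff1_less[rotated])
      ultimately have "fact (Suc n) \<le> card (shrinking_sequences X R \<sigma> B (\<Gamma> - {y}) (Suc n))"
        using less.prems na by (intro less.hyps) auto
      also have "\<dots> \<le> card (shrinking_sequences X R \<sigma> B \<Gamma> (Suc n))"
        by (intro card_mono finite_shrinking_sequences[OF less.prems(1)])
          (auto simp: shrinking_sequences_def)
      finally show ?thesis .
    next
      case False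
      \<comment> \<open>The induction hypothesis is applied in degree \<open>m\<close>, where
        \<open>n = Suc m\<close>.\<close>
      have IH: "fact n \<le> card (?S y)" if y: "y \<in> \<Gamma>" for y
      proof -
        have "card (\<Gamma> - {y}) < card \<Gamma>"
          using y less.prems(1) by (rule card_Diff1_less[rotated])
        moreover have "insert y B \<union> (\<Gamma> - {y}) = B \<union> \<Gamma>" using y by auto
        ultimately show ?thesis
          unfolding Suc using False y less.prems by (intro less.hyps) auto
      qed
      have informative: "psi X R (insert y B) \<noteq> psi X R B" if y: "y \<in> \<Gamma>" for y
      proof
        assume "psi X R (insert y B) = psi X R B"
        moreover have "y \<notin> B" using y less.prems(3) by auto
        ultimately show False
          using acyclic_at_face_interval_uninformative[OF less.prems(1,2) y _ less.prems(4)]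
            less.prems(6) Suc by blast
      qed
      \<comment> \<open>A simplex with \<open>n\<close> vertices forces \<open>\<Gamma>\<close> to
        have \<open>Suc n\<close> elements, which supplies the missing factor of the
        factorial.\<close>
      obtain vs where "length vs = n" "distinct vs" "set vs \<in> order_complex (\<subseteq>) ?F"
        using not_acyclic_at_simplex[OF less.prems(6)] by blast
      then have "Suc n \<le> card \<Gamma>"
        using face_interval_simplex_length[OF less.prems(1,5)] \<Gamma> by (metis Suc_leI)
      then have "fact (Suc n) \<le> card \<Gamma> * (fact n :: nat)" by (simp del: mult_Suc)
      also have "\<dots> = (\<Sum>y\<in>\<Gamma>. fact n)" by simp
      also have "\<dots> \<le> (\<Sum>y\<in>\<Gamma>. card (?S y))" by (intro sum_mono IH)
      \<comment> \<open>The first entry \<open>y\<close> keeps the images disjoint.\<close>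
      also have "\<dots> = card (\<Union>y\<in>\<Gamma>. (#) y ` ?S y)"
        using less.prems(1)
        by (subst card_UN_disjoint) (auto simp: card_image finite_shrinking_sequences)
      finally have le: "fact (Suc n) \<le> card (\<Union>y\<in>\<Gamma>. (#) y ` ?S y)" .
      have "(\<Union>y\<in>\<Gamma>. (#) y ` ?S y) \<subseteq> shrinking_sequences X R \<sigma> B \<Gamma> (Suc n)"
      proof safe
        fix y ys assume "y \<in> \<Gamma>" "ys \<in> ?S y"
        then show "y # ys \<in> shrinking_sequences X R \<sigma> B \<Gamma> (Suc n)"
          using shrinking_sequences_Cons informative by metis
      qed
      then have "card (\<Union>y\<in>\<Gamma>. (#) y ` ?S y) \<le> card (shrinking_sequences X R \<sigma> B \<Gamma> (Suc n))"
        by (rule card_mono[OF finite_shrinking_sequences[OF less.prems(1)]])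
      with le show ?thesis by (rule order_trans)
    qed
  qed
qed

section \<open>From the link poset to faces\<close>

text \<open>Any element of \<open>A\<close> puts all individuals of
  \<open>psi X R A - \<sigma>\<close> into \<open>link_individuals X R \<sigma> \<gamma>\<close>;
  hence \<open>A\<close> must be nonempty.\<close>

lemma psi_link_relation:
  assumes "A \<noteq> {}" "A \<subseteq> \<gamma>"
  shows "psi (link_individuals X R \<sigma> \<gamma>) (link_relation X R \<sigma> \<gamma>) A = psi X R A - \<sigma>"
  using assms
  by (auto simp: psi_def link_relation_def link_individuals_def individuals_with_def)

lemma acyclic_at_link_poset:
  assumes \<gamma>: "finite \<gamma>" and X: "finite X"
    and \<sigma>: "\<sigma> \<noteq> X" "psi X R \<gamma> = \<sigma>"
    and ac: "acyclic_at n (order_complex (\<subseteq>) (face_interval X R \<sigma> {} \<gamma>))"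
  shows "acyclic_at n (order_complex dl_le (link_poset X R \<sigma> \<gamma>))"
proof -
  let ?X = "link_individuals X R \<sigma> \<gamma>" and ?R = "link_relation X R \<sigma> \<gamma>"
  let ?P = "link_poset X R \<sigma> \<gamma>" and ?F = "face_interval X R \<sigma> {} \<gamma>"
  \<comment> \<open>\<open>r\<close> closes a face to a pair, and the order-reversing map
    \<open>snd\<close> is its section.\<close>
  define r where "r A = (psi ?X ?R A, phi \<gamma> ?R (psi ?X ?R A))" for A
  have P: "snd p \<noteq> {}" "snd p \<subseteq> \<gamma>" "fst p \<noteq> {}" "r (snd p) = p" "snd p = phi \<gamma> ?R (fst p)"
    if "p \<in> ?P" for p
  proof -
    obtain s g where p: "p = (s, g)" "s \<noteq> {}" "g \<noteq> {}" "s = psi ?X ?R g" "g = phi \<gamma> ?R s"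
      using \<open>p \<in> ?P\<close> unfolding link_poset_def labeled_pairs_def by blast
    have "phi \<gamma> ?R s \<subseteq> \<gamma>" by (auto simp: phi_def)
    then have "g \<subseteq> \<gamma>" by (subst p(5))
    then show "snd p \<noteq> {}" "snd p \<subseteq> \<gamma>" "fst p \<noteq> {}" "r (snd p) = p" "snd p = phi \<gamma> ?R (fst p)"
      using p(2,3) by (simp_all add: r_def p(1) flip: p(4,5))
  qed
  have snd: "snd p \<in> ?F" if p: "p \<in> ?P" for p
  proof -
    \<comment> \<open>This difference is \<open>fst p\<close>.\<close>
    have "psi X R (snd p) - \<sigma> \<noteq> {}"
      using psi_link_relation[OF P(1,2)[OF p], of X R \<sigma>] P(3,4)[OF p] by (metis fst_conv r_def)
    then show ?thesis using P[OF p] by (auto simp: face_interval_def)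
  qed
  have r: "r A \<in> ?P" if A: "A \<in> ?F" for A
  proof -
    let ?s = "psi ?X ?R A"
    have A': "A \<noteq> {}" "A \<subseteq> \<gamma>" "psi X R A \<noteq> \<sigma>" using A by (auto simp: face_interval_def)
    \<comment> \<open>As \<open>A \<subseteq> \<gamma>\<close>, \<open>psi X R A\<close> contains
      \<open>\<sigma>\<close>; being different, it has an individual outside
      \<open>\<sigma>\<close>.\<close>
    have "?s \<noteq> {}"
      using psi_link_relation[OF A'(1,2), of X R \<sigma>] A'(3) psi_antimono[OF A'(2), of X R] \<sigma>(2) by auto
    then obtain x where x: "x \<in> ?s" by blast
    then have X: "x \<in> ?X" by (simp add: psi_def)
    obtain y where y: "y \<in> A" using A'(1) by blast
    have AR: "(x, y) \<in> ?R" if "x \<in> ?s" "y \<in> A" for x y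
      using that by (auto simp: psi_def individuals_with_def)
    have cl: "A \<subseteq> phi \<gamma> ?R ?s"
      using A'(2) AR by (auto simp: phi_def attributes_of_def)
    have "psi ?X ?R (phi \<gamma> ?R ?s) = ?s"
    proof
      show "psi ?X ?R (phi \<gamma> ?R ?s) \<subseteq> ?s" by (rule psi_antimono[OF cl])
      show "?s \<subseteq> psi ?X ?R (phi \<gamma> ?R ?s)"
        by (rule subset_psi_phi) (auto simp: psi_def)
    qed
    moreover have "?s \<in> Psi ?X \<gamma> ?R"
    proof -
      have "?s \<subseteq> ?X" by (auto simp: psi_def)
      moreover have "y \<in> \<gamma>" "\<forall>x\<in>?s. (x, y) \<in> ?R" using y A'(2) AR by auto
      ultimately show ?thesis unfolding Psi_def by blast
    qed
    moreover have "phi \<gamma> ?R ?s \<in> Phi ?X \<gamma> ?R"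
    proof -
      have "phi \<gamma> ?R ?s \<subseteq> \<gamma>" "\<forall>y\<in>phi \<gamma> ?R ?s. (x, y) \<in> ?R"
        using x by (auto simp: phi_def attributes_of_def)
      then show ?thesis using X unfolding Phi_def by blast
    qed
    ultimately show ?thesis
      using X \<sigma>(1) \<open>?s \<noteq> {}\<close> cl y
      by (auto simp: r_def link_poset_def labeled_pairs_def link_Phi_def link_Psi_def)
  qed
  have finX: "finite ?X"
    using X by (rule finite_subset[rotated]) (auto simp: link_individuals_def individuals_with_def)
  have "?P \<subseteq> Pow ?X \<times> Pow \<gamma>"
    by (auto simp: link_poset_def labeled_pairs_def psi_def phi_def)
  then have finP: "finite ?P"
    using finX \<gamma> by (meson finite_Pow_iff finite_SigmaI finite_subset)
  show ?thesis
  proof (rule acyclic_at_retract[where f = snd and r = r and V = ?P and W = ?F, OF _ _ _ finP])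
    show "finite ?F" by (rule finite_face_interval[OF \<gamma> finite.emptyI])
    show "snd ` S \<in> order_complex (\<subseteq>) ?F" if S: "S \<in> order_complex dl_le ?P" for S
    proof -
      have "snd p \<subseteq> snd q \<or> snd q \<subseteq> snd p" if "p \<in> S" "q \<in> S" for p q
      proof -
        have "p \<in> ?P" "q \<in> ?P" "fst p \<subseteq> fst q \<or> fst q \<subseteq> fst p"
          using S that unfolding order_complex_def Complete_Partial_Order.chain_def dl_le_def by auto
        then show ?thesis using P(5)[of p] P(5)[of q] unfolding phi_def by auto
      qed
      then show ?thesis
        using S snd unfolding order_complex_def Complete_Partial_Order.chain_def by auto
    qed
    show "r ` S \<in> order_complex dl_le ?P" if S: "S \<in> order_complex (\<subseteq>) ?F" for S
    proof -
      have "dl_le (r A) (r B) \<or> dl_le (r B) (r A)" if "A \<in> S" "B \<in> S" for A B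
        using S that psi_antimono[of A B ?X ?R] psi_antimono[of B A ?X ?R]
        unfolding order_complex_def Complete_Partial_Order.chain_def dl_le_def r_def by auto
      then show ?thesis
        using S r unfolding order_complex_def Complete_Partial_Order.chain_def by auto
    qed
  qed (use P snd ac in \<open>auto simp: order_complex_def\<close>)
qed

section \<open>From shrinking sequences to informative release sequences\<close>

lemma shrinking_nth:
  assumes "shrinking X R B ys" "i < length ys"
  shows "psi X R (insert (ys ! i) (B \<union> set (take i ys))) \<noteq> psi X R (B \<union> set (take i ys))"
  using assms
proof (induction ys arbitrary: B i)
  case (Cons y ys)
  then show ?case using Cons.IH[of "insert y B" "i - 1"] by (cases i) (auto simp: insert_commute)
qed simp

text \<open>An individual lost at step \<open>i\<close> matches all earlier attributes but lacks
  \<open>ys ! i\<close>, so the earlier attributes do not imply \<open>ys ! i\<close>.\<close>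

lemma shrinking_informative:
  assumes "ys \<in> shrinking_sequences X R \<sigma> {} \<gamma> (Suc n)" "\<gamma> \<subseteq> Y"
  shows "informative_release_sequence X Y R ys \<and> Suc n \<le> length ys \<and> psi X R (set ys) = \<sigma>"
proof -
  have "ys ! i \<notin> phi Y R (psi X R (set (take i ys)))" if "i < length ys" for i
  proof -
    have "psi X R (insert (ys ! i) (set (take i ys))) \<noteq> psi X R (set (take i ys))"
      using shrinking_nth[of X R "{}" ys i] assms that by (simp add: shrinking_sequences_def)
    then obtain x where "x \<in> psi X R (set (take i ys))" "(x, ys ! i) \<notin> R"
      unfolding psi_insert by (auto simp: individuals_with_def psi_def)
    then show ?thesis by (auto simp: phi_def attributes_of_def)
  qed
  then show ?thesis
    using assms
    by (auto simp: shrinking_sequences_def informative_release_sequence_def attribute_release_sequence_def)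
qed

theorem corollary28:
  fixes X :: "'a set" and Y :: "'b set" and R :: "('a \<times> 'b) set"
    and \<sigma> :: "'a set" and \<gamma> :: "'b set" and k :: nat
  assumes "finite X" and "finite Y"
    and "nonvoid_relation X Y R"
    and "(\<sigma>, \<gamma>) \<in> doubly_labeled_poset X Y R"
    and "link_poset_defined X R \<sigma> \<gamma>"
    and "\<not> trivial_group (reduced_homology_group k (order_complex dl_le (link_poset X R \<sigma> \<gamma>)))"
  shows "fact (k + 2) \<le> card {ys. informative_release_sequence X Y R ys \<and>
                                   length ys \<ge> k + 2 \<and> psi X R (set ys) = \<sigma>}
       \<and> r_slow X Y R \<sigma> \<ge> k + 2"
proof -
  define I where "I = {ys. informative_release_sequence X Y R ys \<and> k + 2 \<le> length ys \<and> psi X R (set ys) = \<sigma>}"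
  define L where "L = {ys. informative_release_sequence X Y R ys \<and> psi X R (set ys) = \<sigma>}"
  have "\<gamma> = phi Y R \<sigma>" and \<gamma>_\<sigma>: "psi X R \<gamma> = \<sigma>"
    using assms(4) unfolding doubly_labeled_poset_def labeled_pairs_def by blast+
  then have \<gamma>: "\<gamma> \<subseteq> Y" by (metis Int_lower1 phi_def)
  have fin\<gamma>: "finite \<gamma>" using \<gamma> assms(2) by (rule finite_subset)
  have \<sigma>: "\<sigma> \<noteq> X" using assms(5) by (auto simp: link_poset_defined_def link_Phi_def)
  have "\<not> acyclic_at (Suc k) (order_complex dl_le (link_poset X R \<sigma> \<gamma>))"
    using assms(6) trivial_reduced_homology_group[OF order_complex_subset] by blast
  then have "\<not> acyclic_at (Suc k) (order_complex (\<subseteq>) (face_interval X R \<sigma> {} \<gamma>))"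
    using acyclic_at_link_poset[OF fin\<gamma> assms(1) \<sigma> \<gamma>_\<sigma>] by blast
  moreover have "psi X R {} \<noteq> \<sigma>" using \<sigma> by (simp add: psi_def)
  \<comment> \<open>Dimension \<open>k\<close> is degree \<open>Suc k\<close>, and the count adds
    one more, so lengths start at \<open>k + 2\<close>.\<close>
  ultimately have le: "fact (k + 2) \<le> card (shrinking_sequences X R \<sigma> {} \<gamma> (Suc (Suc k)))"
    using card_shrinking_sequences[of \<gamma> "{}" X R \<sigma> "Suc k"] fin\<gamma> \<gamma>_\<sigma> by simp
  \<comment> \<open>Release sequences repeat nothing and \<open>Y\<close> is finite, so
    \<open>Max\<close> in \<open>r_slow\<close> bounds every length.\<close>
  have finL: "finite L"
    using finite_subset_distinct[OF assms(2)] unfolding L_def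
    by (rule rev_finite_subset)
      (auto simp: informative_release_sequence_def attribute_release_sequence_def)
  then have finI: "finite I" by (rule rev_finite_subset) (auto simp: I_def L_def)
  have "shrinking_sequences X R \<sigma> {} \<gamma> (Suc (Suc k)) \<subseteq> I"
    using shrinking_informative[OF _ \<gamma>, of _ X R \<sigma> "Suc k"] by (auto simp: I_def)
  then have "card (shrinking_sequences X R \<sigma> {} \<gamma> (Suc (Suc k))) \<le> card I"
    by (rule card_mono[OF finI])
  with le have card: "fact (k + 2) \<le> card I" by (rule order_trans)
  then have "I \<noteq> {}" using fact_gt_zero[of "k + 2", where 'a = nat] by fastforce
  then obtain ys where ys: "ys \<in> I" by blast
  then have "length ys \<in> length ` L" by (auto simp: I_def L_def)
  moreover have "r_slow X Y R \<sigma> = Max (length ` L)"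
    unfolding r_slow_def L_def by (rule arg_cong[where f = Max]) blast
  ultimately have "length ys \<le> r_slow X Y R \<sigma>" using finL by simp
  moreover have "k + 2 \<le> length ys" using ys by (simp add: I_def)
  ultimately show ?thesis using card unfolding I_def by simp
qed

end
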